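(* Let $M$ be a complete $m$-dimensional Riemannian manifold, let $n>m$, and let $h:M\to\mathbb R^n$ be a substantial $C^1$ isometric immersion for which the Grassmannian-valued Gauss map $\mathcal G:M\to G(n-m,n)$, given by $\mathcal G(p)=[h_*T_pM]^{\perp}$, is uniformly continuous. Then either $\operatorname{Conv}[h(M)]=\mathbb R^n$, or each point in the boundary of $\operatorname{Conv}[h(M)]$ admits at most $n-m$ supporting hyperplanes in general position.
   Context: $\operatorname{Conv}(A)$ denotes the convex hull of $A\subset\mathbb R^n$; it need not be closed, and its boundary is its topological boundary in $\mathbb R^n$. The map $h$ is substantial if $h(M)$ is not contained in a proper affine subspace of $\mathbb R^n$. $G(k,n)$ is the Grassmannian of $k$-dimensional linear subspaces of $\mathbb R^n$ with its standard metric; uniform continuity of $\mathcal G$ is with respect to the Riemannian distance on $M$ and this metric. Isometric means that the Riemannian metric of $M$ is the one induced by $h$ from the Euclidean metric. A supporting hyperplane of $C=\operatorname{Conv}[h(M)]$ at a boundary point $p$ is an affine hyperplane through $p$ such that $C$ is contained in one of the two closed half-spaces it bounds. Hyperplanes $H_1,\dots,H_s$ through $p$ are in general position if their unit normal vectors are linearly independent. The conclusion "admits at most $n-m$ supporting hyperplanes in general position" means: whenever $H_1,\dots,H_s$ are supporting hyperplanes at $p$ in general position, $s\le n-m$. Manifolds are connected and without boundary. *)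

theory Defs
  imports "HOL-Analysis.Analysis"
begin

section \<open>Manifolds of class C1\<close>

definition C1_on :: "('a::real_normed_vector \<Rightarrow> 'b::real_normed_vector) \<Rightarrow> 'a set \<Rightarrow> bool" where
  "C1_on f S \<longleftrightarrow>
     (\<exists>f'. (\<forall>x\<in>S. (f has_derivative blinfun_apply (f' x)) (at x)) \<and> continuous_on S f')"

text \<open>A chart is a pair of its domain and its coordinate map; the values of the coordinate map
  outside the domain are irrelevant.\<close>

type_synonym ('a, 'm) chart = "'a set \<times> ('a \<Rightarrow> real ^ 'm)"

definition chart_inv :: "('a, 'm) chart \<Rightarrow> real ^ 'm \<Rightarrow> 'a" where
  "chart_inv c = inv_into (fst c) (snd c)"

definition transition :: "('a, 'm) chart \<Rightarrow> ('a, 'm) chart \<Rightarrow> real ^ 'm \<Rightarrow> real ^ 'm" where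
  "transition c c' = snd c' \<circ> chart_inv c"

definition charts_at :: "('a, 'm) chart set \<Rightarrow> 'a \<Rightarrow> ('a, 'm) chart set" where
  "charts_at A p = {c \<in> A. p \<in> fst c}"

locale C1_manifold =
  fixes X :: "'a topology" and A :: "('a, 'm::finite) chart set"
  assumes Hausdorff: "Hausdorff_space X"
    and second_countable: "second_countable X"
    and connected: "connected_space X"
    and covers: "topspace X = (\<Union>c\<in>A. fst c)"
    and open_domain: "\<And>c. c \<in> A \<Longrightarrow> openin X (fst c)"
    and open_range: "\<And>c. c \<in> A \<Longrightarrow> open (snd c ` fst c)"
    and homeomorphic: "\<And>c. c \<in> A \<Longrightarrow>
      homeomorphic_map (subtopology X (fst c)) (top_of_set (snd c ` fst c)) (snd c)"
    and C1_transition: "\<And>c c'. c \<in> A \<Longrightarrow> c' \<in> A \<Longrightarrow>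
      C1_on (transition c c') (snd c ` (fst c \<inter> fst c'))"


section \<open>Tangent vectors\<close>

text \<open>A tangent vector at \<open>p\<close> is the family of its coordinates in all charts around \<open>p\<close>, related by
  the derivatives of the transition maps. The family is \<open>0\<close> at all other charts, so that it is
  determined by the vector.\<close>

type_synonym ('a, 'm) tangent = "('a, 'm) chart \<Rightarrow> real ^ 'm"

definition tangent_space :: "('a, 'm::finite) chart set \<Rightarrow> 'a \<Rightarrow> ('a, 'm) tangent set" where
  "tangent_space A p =
     {v. (\<forall>c\<in>charts_at A p. \<forall>c'\<in>charts_at A p.
            v c' = frechet_derivative (transition c c') (at (snd c p)) (v c)) \<and>
         (\<forall>c. c \<notin> charts_at A p \<longrightarrow> v c = 0)}"

text \<open>The tangent vector at \<open>p\<close> whose coordinates in the chart \<open>c\<close> are \<open>x\<close>.\<close>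

definition tangent_of_coords ::
    "('a, 'm::finite) chart set \<Rightarrow> ('a, 'm) chart \<Rightarrow> 'a \<Rightarrow> real ^ 'm \<Rightarrow> ('a, 'm) tangent" where
  "tangent_of_coords A c p x =
     (\<lambda>c'. if c' \<in> charts_at A p then frechet_derivative (transition c c') (at (snd c p)) x else 0)"

definition velocity ::
    "('a, 'm::finite) chart set \<Rightarrow> (real \<Rightarrow> 'a) \<Rightarrow> real \<Rightarrow> ('a, 'm) tangent" where
  "velocity A \<gamma> t =
     (\<lambda>c. if c \<in> charts_at A (\<gamma> t)
          then vector_derivative (snd c \<circ> \<gamma>) (at t within {0..1}) else 0)"

text \<open>The differential of a map into a Euclidean space. By the transformation law of tangent
  vectors and the chain rule, the value does not depend on the chart that is chosen.\<close>

definition pushforward ::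
    "('a, 'm::finite) chart set \<Rightarrow> ('a \<Rightarrow> real ^ 'n::finite) \<Rightarrow> 'a \<Rightarrow> ('a, 'm) tangent \<Rightarrow> real ^ 'n" where
  "pushforward A h p v =
     (let c = (SOME c. c \<in> charts_at A p)
      in frechet_derivative (h \<circ> chart_inv c) (at (snd c p)) (v c))"


section \<open>Riemannian manifolds\<close>

text \<open>The manifold is of class C1 and the metric is continuous, which is the regularity of the
  metric that a C1 immersion induces. Smooth Riemannian manifolds are instances.\<close>

locale riemannian_manifold = C1_manifold X A
  for X :: "'a topology" and A :: "('a, 'm::finite) chart set" +
  fixes g :: "'a \<Rightarrow> ('a, 'm) tangent \<Rightarrow> ('a, 'm) tangent \<Rightarrow> real"
  assumes symmetric: "\<And>p u v. p \<in> topspace X \<Longrightarrow> u \<in> tangent_space A p \<Longrightarrow> v \<in> tangent_space A p \<Longrightarrow>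
      g p u v = g p v u"
    and linear: "\<And>p u v w a b. p \<in> topspace X \<Longrightarrow>
      u \<in> tangent_space A p \<Longrightarrow> v \<in> tangent_space A p \<Longrightarrow> w \<in> tangent_space A p \<Longrightarrow>
      g p (\<lambda>c. a *\<^sub>R u c + b *\<^sub>R v c) w = a * g p u w + b * g p v w"
    and positive: "\<And>p v. p \<in> topspace X \<Longrightarrow> v \<in> tangent_space A p \<Longrightarrow> v \<noteq> (\<lambda>c. 0) \<Longrightarrow> g p v v > 0"
    and continuous: "\<And>c x y. c \<in> A \<Longrightarrow>
      continuous_map (subtopology X (fst c)) euclideanreal
        (\<lambda>p. g p (tangent_of_coords A c p x) (tangent_of_coords A c p y))"

text \<open>C1 up to the end points \<open>a\<close> and \<open>b\<close>, where the derivatives are one-sided.\<close>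

definition C1_curve_on :: "('a, 'm::finite) chart set \<Rightarrow> real \<Rightarrow> real \<Rightarrow> (real \<Rightarrow> 'a) \<Rightarrow> bool" where
  "C1_curve_on A a b \<gamma> \<longleftrightarrow>
     (\<forall>c\<in>A. \<exists>w.
        (\<forall>t\<in>{t \<in> {a..b}. \<gamma> t \<in> fst c}. (snd c \<circ> \<gamma> has_vector_derivative w t) (at t within {a..b})) \<and>
        continuous_on {t \<in> {a..b}. \<gamma> t \<in> fst c} w)"

definition piecewise_C1_path ::
    "'a topology \<Rightarrow> ('a, 'm::finite) chart set \<Rightarrow> (real \<Rightarrow> 'a) \<Rightarrow> bool" where
  "piecewise_C1_path X A \<gamma> \<longleftrightarrow>
     pathin X \<gamma> \<and>
     (\<exists>S. finite S \<and>
          (\<forall>a b. 0 \<le> a \<and> a < b \<and> b \<le> 1 \<and> {a<..<b} \<inter> S = {} \<longrightarrow> C1_curve_on A a b \<gamma>))"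

text \<open>For a piecewise C1 path the integrand is bounded and has finitely many discontinuities, so
  the integral exists.\<close>

definition riemannian_length ::
    "('a, 'm::finite) chart set \<Rightarrow> ('a \<Rightarrow> ('a, 'm) tangent \<Rightarrow> ('a, 'm) tangent \<Rightarrow> real) \<Rightarrow>
      (real \<Rightarrow> 'a) \<Rightarrow> real" where
  "riemannian_length A g \<gamma> =
     integral {0..1} (\<lambda>t. sqrt (g (\<gamma> t) (velocity A \<gamma> t) (velocity A \<gamma> t)))"

text \<open>The value \<open>0\<close> outside the manifold is needed because \<^locale>\<open>Metric_space\<close> asks for symmetry and
  nonnegativity at all elements of the type.\<close>

definition riemannian_dist ::
    "'a topology \<Rightarrow> ('a, 'm::finite) chart set \<Rightarrow>
      ('a \<Rightarrow> ('a, 'm) tangent \<Rightarrow> ('a, 'm) tangent \<Rightarrow> real) \<Rightarrow> 'a \<Rightarrow> 'a \<Rightarrow> real" where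
  "riemannian_dist X A g p q =
     (if p \<in> topspace X \<and> q \<in> topspace X
      then Inf (riemannian_length A g ` {\<gamma>. piecewise_C1_path X A \<gamma> \<and> \<gamma> 0 = p \<and> \<gamma> 1 = q})
      else 0)"

definition riemannian_metric ::
    "'a topology \<Rightarrow> ('a, 'm::finite) chart set \<Rightarrow>
      ('a \<Rightarrow> ('a, 'm) tangent \<Rightarrow> ('a, 'm) tangent \<Rightarrow> real) \<Rightarrow> 'a metric" where
  "riemannian_metric X A g = metric (topspace X, riemannian_dist X A g)"


section \<open>Isometric immersions into Euclidean space\<close>

definition C1_immersion ::
    "'a topology \<Rightarrow> ('a, 'm::finite) chart set \<Rightarrow> ('a \<Rightarrow> real ^ 'n::finite) \<Rightarrow> bool" where
  "C1_immersion X A h \<longleftrightarrow>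
     (\<forall>c\<in>A. C1_on (h \<circ> chart_inv c) (snd c ` fst c)) \<and>
     (\<forall>p\<in>topspace X. inj_on (pushforward A h p) (tangent_space A p))"

definition isometric ::
    "'a topology \<Rightarrow> ('a, 'm::finite) chart set \<Rightarrow>
      ('a \<Rightarrow> ('a, 'm) tangent \<Rightarrow> ('a, 'm) tangent \<Rightarrow> real) \<Rightarrow> ('a \<Rightarrow> real ^ 'n::finite) \<Rightarrow> bool" where
  "isometric X A g h \<longleftrightarrow>
     (\<forall>p\<in>topspace X. \<forall>u\<in>tangent_space A p. \<forall>v\<in>tangent_space A p.
        g p u v = pushforward A h p u \<bullet> pushforward A h p v)"

definition substantial :: "'a topology \<Rightarrow> ('a \<Rightarrow> real ^ 'n::finite) \<Rightarrow> bool" where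
  "substantial X h \<longleftrightarrow> \<not> (\<exists>S. affine S \<and> S \<noteq> UNIV \<and> h ` topspace X \<subseteq> S)"

definition gauss_map ::
    "('a, 'm::finite) chart set \<Rightarrow> ('a \<Rightarrow> real ^ 'n::finite) \<Rightarrow> 'a \<Rightarrow> (real ^ 'n) set" where
  "gauss_map A h p = (pushforward A h p ` tangent_space A p)\<^sup>\<bottom>"


section \<open>The Grassmannian\<close>

definition grassmannian :: "nat \<Rightarrow> (real ^ 'n::finite) set set" where
  "grassmannian k = {V. subspace V \<and> dim V = k}"

text \<open>The distance is the operator norm of the difference of the orthogonal projections; on a closed
  subspace, \<^const>\<open>closest_point\<close> is the orthogonal projection.\<close>

definition grassmannian_dist :: "nat \<Rightarrow> (real ^ 'n::finite) set \<Rightarrow> (real ^ 'n) set \<Rightarrow> real" where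
  "grassmannian_dist k V W =
     (if V \<in> grassmannian k \<and> W \<in> grassmannian k
      then onorm (\<lambda>x. closest_point V x - closest_point W x) else 0)"

definition grassmannian_metric :: "nat \<Rightarrow> (real ^ 'n::finite) set metric" where
  "grassmannian_metric k = metric (grassmannian k, grassmannian_dist k)"

lemma closest_point_subspace_eq:
  fixes V :: "(real ^ 'n::finite) set"
  assumes V: "subspace V" and y: "y \<in> V" and orth: "\<And>v. v \<in> V \<Longrightarrow> (x - y) \<bullet> v = 0"
  shows "closest_point V x = y"
proof -
  have "dist x y \<le> dist x z" if z: "z \<in> V" for z
  proof -
    have "(x - y) \<bullet> (y - z) = 0"
      using orth subspace_diff[OF V y z] by blast
    then have "(norm (x - z))\<^sup>2 = (norm (x - y))\<^sup>2 + (norm (y - z))\<^sup>2"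
      using norm_add_Pythagorean[of "x - y" "y - z"] by (simp add: orthogonal_def)
    then show ?thesis
      by (simp add: dist_norm norm_le_square power2_eq_square flip: power2_norm_eq_inner)
  qed
  then show ?thesis
    using closest_point_unique[OF subspace_imp_convex[OF V] closed_subspace[OF V] y] by metis
qed

lemma closest_point_subspace:
  fixes V :: "(real ^ 'n::finite) set"
  assumes V: "subspace V"
  shows "closest_point V x \<in> V" and "v \<in> V \<Longrightarrow> (x - closest_point V x) \<bullet> v = 0"
proof -
  obtain y z where yz: "y \<in> span V" "\<And>w. w \<in> span V \<Longrightarrow> orthogonal z w" "x = y + z"
    using orthogonal_subspace_decomp_exists[of V x] by metis
  have [simp]: "span V = V"
    using V by (simp add: span_eq_iff)
  have "closest_point V x = y"
    by (rule closest_point_subspace_eq[OF V]) (use yz in \<open>auto simp: orthogonal_def\<close>)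
  then show "closest_point V x \<in> V" "v \<in> V \<Longrightarrow> (x - closest_point V x) \<bullet> v = 0"
    using yz by (auto simp: orthogonal_def)
qed

lemma bounded_linear_closest_point:
  fixes V :: "(real ^ 'n::finite) set"
  assumes V: "subspace V"
  shows "bounded_linear (closest_point V)"
proof -
  have "linear (closest_point V)"
  proof (rule linearI)
    fix x y :: "real ^ 'n" and r :: real
    show "closest_point V (x + y) = closest_point V x + closest_point V y"
    proof (rule closest_point_subspace_eq[OF V])
      show "closest_point V x + closest_point V y \<in> V"
        by (simp add: V closest_point_subspace(1) subspace_add)
      show "(x + y - (closest_point V x + closest_point V y)) \<bullet> v = 0" if "v \<in> V" for v
        using closest_point_subspace(2)[OF V that, of x] closest_point_subspace(2)[OF V that, of y]
        by (simp add: inner_simps)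
    qed
    show "closest_point V (r *\<^sub>R x) = r *\<^sub>R closest_point V x"
    proof (rule closest_point_subspace_eq[OF V])
      show "r *\<^sub>R closest_point V x \<in> V"
        by (simp add: V closest_point_subspace(1) subspace_scale)
      show "(r *\<^sub>R x - r *\<^sub>R closest_point V x) \<bullet> v = 0" if "v \<in> V" for v
        using closest_point_subspace(2)[OF V that, of x]
        by (simp add: inner_simps flip: right_diff_distrib)
    qed
  qed
  then show ?thesis
    by (simp add: linear_conv_bounded_linear)
qed

lemma Metric_space_grassmannian:
  "Metric_space (grassmannian k) (grassmannian_dist k :: (real ^ 'n::finite) set \<Rightarrow> _)"
proof -
  have bl: "bounded_linear (\<lambda>x. closest_point V x - closest_point W x)"
    if "V \<in> grassmannian k" "W \<in> grassmannian k" for V W :: "(real ^ 'n) set"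
    using that by (auto simp: grassmannian_def intro: bounded_linear_sub bounded_linear_closest_point)
  show ?thesis
  proof
    fix U V W :: "(real ^ 'n) set"
    show "0 \<le> grassmannian_dist k V W"
      by (simp add: grassmannian_dist_def onorm_pos_le bl)
    show "grassmannian_dist k V W = grassmannian_dist k W V"
      using onorm_neg[of "\<lambda>x. closest_point V x - closest_point W x"]
      by (simp add: grassmannian_dist_def)
    assume V: "V \<in> grassmannian k" and W: "W \<in> grassmannian k"
    then have sub: "subspace V" "subspace W"
      by (auto simp: grassmannian_def)
    show "grassmannian_dist k V W = 0 \<longleftrightarrow> V = W"
    proof
      assume "grassmannian_dist k V W = 0"
      then have eq: "closest_point V x = closest_point W x" for x
        using V W onorm_eq_0[OF bl[OF V W]] by (simp add: grassmannian_dist_def)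
      have "x \<in> V \<longleftrightarrow> closest_point V x = x" "x \<in> W \<longleftrightarrow> closest_point W x = x" for x
        using closest_point_subspace(1)[OF sub(1), of x] closest_point_subspace(1)[OF sub(2), of x]
        by (auto simp: closest_point_self)
      with eq show "V = W"
        by auto
    qed (simp add: grassmannian_dist_def onorm_zero)
    assume U: "U \<in> grassmannian k"
    show "grassmannian_dist k U W \<le> grassmannian_dist k U V + grassmannian_dist k V W"
      using onorm_triangle[OF bl[OF U V] bl[OF V W]] U V W by (simp add: grassmannian_dist_def)
  qed
qed


section \<open>Supporting hyperplanes\<close>

definition supporting_hyperplane :: "(real ^ 'n::finite) set \<Rightarrow> real ^ 'n \<Rightarrow> (real ^ 'n) set \<Rightarrow> bool" where
  "supporting_hyperplane C p H \<longleftrightarrow>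
     (\<exists>a b. a \<noteq> 0 \<and> H = {x. a \<bullet> x = b} \<and> p \<in> H \<and>
            (C \<subseteq> {x. a \<bullet> x \<le> b} \<or> C \<subseteq> {x. a \<bullet> x \<ge> b}))"

definition unit_normal :: "(real ^ 'n::finite) set \<Rightarrow> real ^ 'n \<Rightarrow> bool" where
  "unit_normal H \<nu> \<longleftrightarrow> norm \<nu> = 1 \<and> (\<exists>b. H = {x. \<nu> \<bullet> x = b})"

text \<open>Unit normals are unique up to sign, so their choice does not matter. The injectivity makes
  \<open>\<nu> 1, \<dots>, \<nu> s\<close> linearly independent as a family, not merely as a set.\<close>

definition general_position :: "nat \<Rightarrow> (nat \<Rightarrow> (real ^ 'n::finite) set) \<Rightarrow> bool" where
  "general_position s H \<longleftrightarrow>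
     (\<exists>\<nu>. (\<forall>i\<in>{1..s}. unit_normal (H i) (\<nu> i)) \<and> inj_on \<nu> {1..s} \<and> independent (\<nu> ` {1..s}))"

end

theory Submission
  imports Defs
begin

text \<open>Let \<open>\<nu> 1, \<dots>, \<nu> s\<close> be the outer unit normals of supporting hyperplanes at \<open>p\<close>. The sum of the
  functions \<open>\<nu> i \<bullet> (x - p)\<close>, none of which is positive on the hull, has supremum \<open>0\<close> on \<open>h(M)\<close>, as \<open>p\<close>
  would otherwise be separated from the closure of the hull. Hence there are points \<open>q\<close> of \<open>M\<close> at which
  all the functions \<open>\<nu> i \<bullet> h\<close> are simultaneously almost maximal. By Ekeland's variational principle on
  the complete metric space \<open>M\<close>, each of them has an almost critical point close to \<open>q\<close>: a point where
  \<open>\<nu> i\<close> is almost normal to the immersion. By uniform continuity of the Gauss map, all the \<open>\<nu> i\<close> are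
  then close to the normal space at the single point \<open>q\<close>. Linearly independent vectors that are
  sufficiently close to a subspace of dimension \<open>n - m\<close> number at most \<open>n - m\<close>. Ekeland's principle
  takes the place of geodesics or gradient flows, which a metric that is only continuous need not
  provide.\<close>

section \<open>Ekeland's variational principle and subspaces close to independent vectors\<close>

text \<open>Maximising form. Membership \<open>y \<in> S x\<close> says that the gain of f from x to
  y pays for the distance at rate e; this is a preorder. A chain of nearly best successors is
  Cauchy, and its limit z has no proper successor. The first inequality for z keeps it close to x0
  whenever f x0 is close to the bound.\<close>

lemma (in Metric_space) ekeland:
  assumes complete: mcomplete and x0: "x0 \<in> M" and "e > 0"
    and cont: "continuous_map mtopology euclideanreal f"
    and bound: "\<And>x. x \<in> M \<Longrightarrow> f x \<le> B"
  obtains z where "z \<in> M" "e * d x0 z \<le> f z - f x0" "\<And>y. y \<in> M \<Longrightarrow> f y \<le> f z + e * d z y"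
proof -
  define S where "S x = {y \<in> M. e * d x y \<le> f y - f x}" for x
  have S_refl: "x \<in> S x" if "x \<in> M" for x
    using that by (simp add: S_def)
  have S_trans: "S y \<subseteq> S x" if "y \<in> S x" "x \<in> M" for x y
  proof
    fix w assume "w \<in> S y"
    moreover from this have "e * d x w \<le> e * d x y + e * d y w"
      using that triangle[of x y w] \<open>e > 0\<close> by (simp add: S_def flip: distrib_left)
    ultimately show "w \<in> S x"
      using that by (auto simp: S_def)
  qed
  have bdd: "bdd_above (f ` S x)" for x
    by (rule bdd_aboveI2[where M = B]) (use bound in \<open>auto simp: S_def\<close>)
  have step: "\<exists>y. y \<in> M \<and> y \<in> S x \<and> (\<forall>w\<in>S x. f w \<le> f y + (1/2)^n)" if "x \<in> M" for x and n :: nat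
  proof -
    have "Sup (f ` S x) - (1/2)^n < Sup (f ` S x)" "f ` S x \<noteq> {}"
      using S_refl[OF that] by auto
    then obtain y where "y \<in> S x" "Sup (f ` S x) - (1/2)^n < f y"
      using less_cSup_iff[OF _ bdd] by blast
    moreover have "f w \<le> Sup (f ` S x)" if "w \<in> S x" for w
      using that by (intro cSup_upper bdd) auto
    ultimately show ?thesis
      by (force simp: S_def)
  qed
  obtain \<sigma> where \<sigma>0: "\<sigma> 0 = x0" and \<sigma>M: "\<And>n. \<sigma> n \<in> M" and \<sigma>S: "\<And>n. \<sigma> (Suc n) \<in> S (\<sigma> n)"
    and \<sigma>max: "\<And>n w. w \<in> S (\<sigma> n) \<Longrightarrow> f w \<le> f (\<sigma> (Suc n)) + (1/2)^n"
  proof -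
    have "\<exists>\<sigma>. \<forall>n. (\<sigma> n \<in> M \<and> (n = 0 \<longrightarrow> \<sigma> n = x0)) \<and>
        (\<sigma> (Suc n) \<in> S (\<sigma> n) \<and> (\<forall>w\<in>S (\<sigma> n). f w \<le> f (\<sigma> (Suc n)) + (1/2)^n))"
      by (rule dependent_nat_choice) (use x0 in blast, use step in auto)
    then show thesis
      using that by blast
  qed
  have S_mono: "S (\<sigma> m) \<subseteq> S (\<sigma> n)" if "n \<le> m" for m n
    using lift_Suc_antimono_le[of "\<lambda>n. S (\<sigma> n)", OF _ that] S_trans \<sigma>S \<sigma>M by blast
  \<comment> \<open>After a nearly best step the gain still available is at most
    \<open>(1/2)^n\<close>, and within S the gain dominates e times the distance. So the nested sets
    \<open>S (\<sigma> n)\<close> shrink to a point.\<close>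
  have near: "e * d (\<sigma> (Suc n)) w \<le> (1/2)^n" if "w \<in> S (\<sigma> (Suc n))" for n w
    using that \<sigma>max[of w n] S_mono[of n "Suc n"] by (force simp: S_def)
  have "MCauchy \<sigma>"
    unfolding MCauchy_def
  proof (intro conjI allI impI)
    show "range \<sigma> \<subseteq> M"
      using \<sigma>M by auto
    fix \<epsilon> :: real assume "\<epsilon> > 0"
    then obtain n where n: "(1/2)^n < e * \<epsilon> / 2"
      using real_arch_pow_inv[of "e * \<epsilon> / 2" "1/2"] \<open>e > 0\<close> by auto
    have *: "d (\<sigma> (Suc n)) (\<sigma> m) < \<epsilon> / 2" if "Suc n \<le> m" for m
    proof -
      have "\<sigma> m \<in> S (\<sigma> (Suc n))"
        using S_mono[OF that] S_refl \<sigma>M by blast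
      then have "e * d (\<sigma> (Suc n)) (\<sigma> m) < e * (\<epsilon> / 2)"
        using near n by fastforce
      then show ?thesis
        using \<open>e > 0\<close> by simp
    qed
    show "\<exists>N. \<forall>m m'. N \<le> m \<longrightarrow> N \<le> m' \<longrightarrow> d (\<sigma> m) (\<sigma> m') < \<epsilon>"
    proof (intro exI[of _ "Suc n"] allI impI)
      fix m m' assume "Suc n \<le> m" "Suc n \<le> m'"
      then show "d (\<sigma> m) (\<sigma> m') < \<epsilon>"
        using *[of m] *[of m'] triangle''[OF \<sigma>M[of m] \<sigma>M[of "Suc n"] \<sigma>M[of m']]
        by (simp add: commute)
    qed
  qed
  then obtain z where lim: "limitin mtopology \<sigma> z sequentially"
    using complete by (auto simp: mcomplete_def)
  then have zM: "z \<in> M"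
    using limitin_mspace by blast
  \<comment> \<open>The sets \<open>S (\<sigma> n)\<close> contain the limit because f is
    continuous: the defining inequality for \<open>\<sigma> m\<close> passes to the limit in
    m.\<close>
  have zS: "z \<in> S (\<sigma> n)" for n
  proof -
    have "(\<lambda>m. d (\<sigma> m) z) \<longlonglongrightarrow> 0"
      using lim \<sigma>M by (simp add: limitin_metric_dist_null)
    moreover have "(\<lambda>m. f (\<sigma> m)) \<longlonglongrightarrow> f z"
      using continuous_map_limit[OF cont lim] by (simp add: o_def)
    ultimately have "(\<lambda>m. f (\<sigma> m) - f (\<sigma> n) + e * d (\<sigma> m) z) \<longlonglongrightarrow> f z - f (\<sigma> n) + e * 0"
      by (intro tendsto_intros)
    moreover have "\<forall>m\<ge>n. e * d (\<sigma> n) z \<le> f (\<sigma> m) - f (\<sigma> n) + e * d (\<sigma> m) z"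
    proof (intro allI impI)
      fix m assume "n \<le> m"
      then have "\<sigma> m \<in> S (\<sigma> n)"
        using S_mono S_refl \<sigma>M by blast
      moreover have "e * d (\<sigma> n) z \<le> e * d (\<sigma> n) (\<sigma> m) + e * d (\<sigma> m) z"
        using triangle[OF \<sigma>M[of n] \<sigma>M[of m] zM] \<open>e > 0\<close> by (simp flip: distrib_left)
      ultimately show "e * d (\<sigma> n) z \<le> f (\<sigma> m) - f (\<sigma> n) + e * d (\<sigma> m) z"
        by (simp add: S_def)
    qed
    ultimately have "e * d (\<sigma> n) z \<le> f z - f (\<sigma> n) + e * 0"
      by (intro LIMSEQ_le_const) auto
    then show ?thesis
      using zM by (simp add: S_def)
  qed
  \<comment> \<open>A counterexample y would lie in every \<open>S (\<sigma> n)\<close>, as z does.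
    The shrinking of these sets forces z = y, against the strict inequality.\<close>
  have "f y \<le> f z + e * d z y" if "y \<in> M" for y
  proof (rule ccontr)
    assume contra: "\<not> ?thesis"
    then have "y \<in> S z"
      using that by (simp add: S_def)
    then have "y \<in> S (\<sigma> n)" for n
      using S_trans[OF zS \<sigma>M] by blast
    then have *: "e * d z y \<le> 2 * (1/2)^n" for n
      using near[of y n] near[of z n] zS
        mult_left_mono[OF triangle''[OF zM \<sigma>M[of "Suc n"] that], of e] \<open>e > 0\<close>
      by (simp add: commute distrib_left)
    have "(\<lambda>n. 2 * (1/2)^n :: real) \<longlonglongrightarrow> 2 * 0"
      by (intro tendsto_intros LIMSEQ_power_zero) auto
    then have "e * d z y \<le> 2 * 0"
      by (rule LIMSEQ_le_const) (use * in auto)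
    then have "z = y"
      using \<open>e > 0\<close> zM that nonneg[of z y] by (simp add: mult_le_0_iff)
    then show False
      using contra zM by simp
  qed
  then show thesis
    using that[OF zM] zS[of 0] \<sigma>0 by (auto simp: S_def)
qed

text \<open>The threshold depends on N alone, not on V. Replacing each basis vector b by a nearby
  point of V extends to a linear map on the span of N that moves every nonzero vector by less than
  its norm; such a map has trivial kernel, so V has room for the span.\<close>

lemma independent_near_subspace:
  fixes N :: "'a::euclidean_space set"
  assumes N: "independent N"
  obtains \<eta> where "\<eta> > 0"
    and "\<And>V. subspace V \<Longrightarrow> (\<And>\<nu>. \<nu> \<in> N \<Longrightarrow> \<exists>y\<in>V. dist \<nu> y < \<eta>) \<Longrightarrow> card N \<le> dim V"
proof -
  have fin: "finite N"
    using N independent_bound by blast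
  \<comment> \<open>Functionals dual to N: on its span, \<open>f b\<close> reads off the coefficient
    of b.\<close>
  have "\<exists>f. \<forall>b\<in>N. linear (f b) \<and> (\<forall>b'\<in>N. f b b' = (if b' = b then 1 else 0 :: real))"
    by (intro bchoice ballI linear_independent_extend N)
  then obtain f where f: "\<And>b. b \<in> N \<Longrightarrow> linear (f b)"
    and fN: "\<And>b b'. b \<in> N \<Longrightarrow> b' \<in> N \<Longrightarrow> f b b' = (if b' = b then 1 else 0 :: real)"
    by metis
  have "\<exists>L. \<forall>b\<in>N. \<forall>x. norm (f b x) \<le> L b * norm x"
    by (intro bchoice ballI) (metis f linear_bounded)
  then obtain L where L: "\<And>b x. b \<in> N \<Longrightarrow> norm (f b x) \<le> L b * norm x"
    by blast
  have lin: "linear (\<lambda>x. \<Sum>b\<in>N. f b x *\<^sub>R y b)" for y :: "'a \<Rightarrow> 'a"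
    by (rule linearI)
      (simp_all add: f linear_add linear_scale scaleR_add_left sum.distrib scaleR_sum_right)
  have expand: "(\<Sum>b\<in>N. f b x *\<^sub>R b) = x" if "x \<in> span N" for x
  proof -
    show ?thesis
    proof (rule linear_eq_on[OF lin linear_id[unfolded id_def] that])
      fix b assume "b \<in> N"
      then show "(\<Sum>b'\<in>N. f b' b *\<^sub>R b') = b"
        using fin by (simp add: fN if_distrib[of "\<lambda>c. c *\<^sub>R _"] cong: if_cong)
    qed
  qed
  \<comment> \<open>The summand 1 makes the denominator positive even for empty N and the product of
    \<eta> with the sum of the coefficient bounds strictly less than 1.\<close>
  define \<eta> where "\<eta> = 1 / (1 + (\<Sum>b\<in>N. \<bar>L b\<bar>))"
  have "1 + (\<Sum>b\<in>N. \<bar>L b\<bar>) > 0"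
    by (intro add_pos_nonneg sum_nonneg) auto
  then have \<eta>: "\<eta> > 0" "(\<Sum>b\<in>N. \<bar>L b\<bar>) * \<eta> < 1"
    by (simp_all add: \<eta>_def)
  show thesis
  proof (rule that[OF \<eta>(1)])
    fix V :: "'a set"
    assume V: "subspace V" and "\<And>\<nu>. \<nu> \<in> N \<Longrightarrow> \<exists>y\<in>V. dist \<nu> y < \<eta>"
    then obtain y where y: "\<And>\<nu>. \<nu> \<in> N \<Longrightarrow> y \<nu> \<in> V" "\<And>\<nu>. \<nu> \<in> N \<Longrightarrow> dist \<nu> (y \<nu>) < \<eta>"
      by metis
    define T where "T x = (\<Sum>b\<in>N. f b x *\<^sub>R y b)" for x
    have T: "linear T"
      unfolding T_def by (rule lin)
    have "inj_on T (span N)"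
    proof (subst linear_inj_on_iff_eq_0[OF T subspace_span], intro ballI impI)
      fix x assume x: "x \<in> span N" "T x = 0"
      \<comment> \<open>If T x = 0, then x is its own displacement x - T x, whose norm is at most a
        factor below 1 times the norm of x.\<close>
      have "norm x = norm (\<Sum>b\<in>N. f b x *\<^sub>R (b - y b))"
        using expand[OF x(1)] x(2) by (simp add: T_def algebra_simps sum_subtractf)
      also have "\<dots> \<le> (\<Sum>b\<in>N. (\<bar>L b\<bar> * norm x) * \<eta>)"
      proof (rule sum_norm_le)
        fix b assume b: "b \<in> N"
        have "\<bar>f b x\<bar> \<le> \<bar>L b\<bar> * norm x"
          using L[OF b, of x] mult_right_mono[OF abs_ge_self norm_ge_zero] by (fastforce intro: order_trans)
        then show "norm (f b x *\<^sub>R (b - y b)) \<le> \<bar>L b\<bar> * norm x * \<eta>"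
          using y(2)[OF b] by (auto simp: dist_norm intro!: mult_mono)
      qed
      also have "\<dots> = ((\<Sum>b\<in>N. \<bar>L b\<bar>) * \<eta>) * norm x"
        by (simp add: sum_distrib_left sum_distrib_right mult_ac)
      finally show "x = 0"
        using \<eta>(2) by (metis less_le_not_le mult_1 mult_strict_right_mono zero_less_norm_iff)
    qed
    then have "card N = dim (T ` N)"
      using N dim_image_eq[OF T] by (simp add: dim_eq_card_independent)
    also have "\<dots> \<le> dim V"
      by (intro dim_subset) (auto simp: T_def y V intro!: subspace_sum subspace_scale)
    finally show "card N \<le> dim V" .
  qed
qed

text \<open>The residual is the component of \<nu> in T, so its inner product with \<nu> is its
  squared norm; the hypothesis is tested on this vector. This turns a slope bound on tangent vectors
  into a distance from the normal space.\<close>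

lemma norm_residual_le:
  fixes T :: "(real ^ 'n::finite) set"
  assumes T: "subspace T" and le: "\<And>w. w \<in> T \<Longrightarrow> \<nu> \<bullet> w \<le> e * norm w" and "e \<ge> 0"
  shows "norm (\<nu> - closest_point (T\<^sup>\<bottom>) \<nu>) \<le> e"
proof -
  let ?w = "\<nu> - closest_point (T\<^sup>\<bottom>) \<nu>"
  have orth: "subspace (T\<^sup>\<bottom>)"
    by (rule subspace_orthogonal_comp)
  have "?w \<in> T\<^sup>\<bottom>\<^sup>\<bottom>"
    using closest_point_subspace(2)[OF orth]
    by (auto simp: orthogonal_comp_def orthogonal_def inner_commute)
  then have "\<nu> \<bullet> ?w \<le> e * norm ?w"
    using le orthogonal_comp_self[OF T] by auto
  moreover have "closest_point (T\<^sup>\<bottom>) \<nu> \<bullet> ?w = 0"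
    using closest_point_subspace(2)[OF orth closest_point_subspace(1)[OF orth]] by (simp add: inner_commute)
  ultimately have "norm ?w * norm ?w \<le> e * norm ?w"
    by (simp add: inner_diff_left flip: power2_eq_square power2_norm_eq_inner)
       (simp add: power2_norm_eq_inner inner_diff_left)
  then show ?thesis
    using \<open>e \<ge> 0\<close> by (cases "?w = 0") auto
qed

section \<open>Charts and tangent vectors\<close>

lemma pathin_near:
  assumes "pathin X \<gamma>" "openin X W" "t \<in> {0..1}" "\<gamma> t \<in> W"
  obtains e where "e > 0" "\<And>s. s \<in> {0..1} \<Longrightarrow> dist s t < e \<Longrightarrow> \<gamma> s \<in> W"
proof -
  have "openin (top_of_set {0..1}) {s \<in> {0..1}. \<gamma> s \<in> W}"
    using assms(1,2) openin_continuous_map_preimage by (fastforce simp: pathin_def)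
  then show thesis
    using assms(3,4) that unfolding openin_euclidean_subtopology_iff by blast
qed

lemma at_within_eq_near:
  fixes t :: real
  assumes "e > 0" "\<And>s. s \<in> I \<Longrightarrow> dist s t < e \<Longrightarrow> s \<in> T" "T \<subseteq> I"
  shows "at t within T = at t within I"
  by (rule at_within_nhd[of _ "ball t e"]) (use assms in \<open>auto simp: dist_commute\<close>)

context C1_manifold
begin

lemma domain_subset: "c \<in> A \<Longrightarrow> fst c \<subseteq> topspace X"
  using covers by blast

lemma obtain_chart:
  assumes "p \<in> topspace X"
  obtains c where "c \<in> A" "p \<in> fst c"
  using assms covers by auto

lemma chart_inv_chart:
  assumes "c \<in> A" "p \<in> fst c"
  shows "chart_inv c (snd c p) = p"
proof -
  have "inj_on (snd c) (fst c)"
    using homeomorphic_imp_injective_map[OF homeomorphic[OF assms(1)]] domain_subset[OF assms(1)]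
    by (simp add: Int_absorb1)
  then show ?thesis
    using assms(2) by (simp add: chart_inv_def)
qed

lemma chart_inv_in: "x \<in> snd c ` fst c \<Longrightarrow> chart_inv c x \<in> fst c"
  and chart_chart_inv: "x \<in> snd c ` fst c \<Longrightarrow> snd c (chart_inv c x) = x"
  by (simp_all add: chart_inv_def inv_into_into f_inv_into_f)

lemma open_chart_image:
  assumes "c \<in> A" "openin X U" "U \<subseteq> fst c"
  shows "open (snd c ` U)"
proof -
  have "openin (subtopology X (fst c)) U"
    using assms by (simp add: open_domain openin_open_subtopology)
  then have "openin (top_of_set (snd c ` fst c)) (snd c ` U)"
    using homeomorphic_imp_open_map[OF homeomorphic[OF assms(1)]] by (simp add: open_map_def)
  then show ?thesis
    using open_range[OF assms(1)] by (simp add: openin_open_eq)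
qed

lemma continuous_map_chart: "c \<in> A \<Longrightarrow> continuous_map (subtopology X (fst c)) euclidean (snd c)"
  using homeomorphic_imp_continuous_map[OF homeomorphic]
  by (auto simp: continuous_map_in_subtopology)

lemma continuous_map_chart_inv:
  assumes "c \<in> A"
  shows "continuous_map (top_of_set (snd c ` fst c)) X (chart_inv c)"
proof (rule continuous_map_openin_preimage_eq[THEN iffD2], intro conjI allI impI)
  show "chart_inv c \<in> topspace (top_of_set (snd c ` fst c)) \<rightarrow> topspace X"
    using chart_inv_in[of _ c] domain_subset[OF assms] by auto
  fix U assume U: "openin X U"
  have "topspace (top_of_set (snd c ` fst c)) \<inter> chart_inv c -` U = snd c ` (fst c \<inter> U)"
    by (auto simp: chart_inv_chart[OF assms])
  moreover have "open (snd c ` (fst c \<inter> U))"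
    using assms U open_domain[OF assms] by (intro open_chart_image) auto
  ultimately show "openin (top_of_set (snd c ` fst c))
      (topspace (top_of_set (snd c ` fst c)) \<inter> chart_inv c -` U)"
    by (auto intro!: open_openin_trans open_range[OF assms])
qed

lemma open_chart_inv_image:
  assumes "c \<in> A" "open U" "U \<subseteq> snd c ` fst c"
  shows "openin X (chart_inv c ` U)"
proof -
  have "openin (subtopology X (fst c)) {p \<in> topspace (subtopology X (fst c)). snd c p \<in> U}"
    by (rule openin_continuous_map_preimage[OF continuous_map_chart[OF assms(1)]])
      (use assms(2) in simp)
  moreover have "{p \<in> topspace (subtopology X (fst c)). snd c p \<in> U} = chart_inv c ` U"
  proof
    show "{p \<in> topspace (subtopology X (fst c)). snd c p \<in> U} \<subseteq> chart_inv c ` U"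
      by (auto intro: rev_image_eqI simp: chart_inv_chart[OF assms(1)])
    show "chart_inv c ` U \<subseteq> {p \<in> topspace (subtopology X (fst c)). snd c p \<in> U}"
    proof
      fix q assume "q \<in> chart_inv c ` U"
      then obtain x where x: "x \<in> U" "q = chart_inv c x"
        by blast
      then have "x \<in> snd c ` fst c"
        using assms(3) by blast
      then have "q \<in> fst c" "snd c q = x"
        using x chart_inv_in[of x c] chart_chart_inv[of x c] by auto
      then show "q \<in> {p \<in> topspace (subtopology X (fst c)). snd c p \<in> U}"
        using x(1) domain_subset[OF assms(1)] by auto
    qed
  qed
  ultimately show ?thesis
    using open_domain[OF assms(1)] by (simp add: openin_open_subtopology)
qed

lemma transition_has_derivative:
  assumes "c \<in> charts_at A p" "c' \<in> charts_at A p"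
  shows "(transition c c' has_derivative frechet_derivative (transition c c') (at (snd c p)))
    (at (snd c p))"
  using C1_transition[of c c'] assms
  unfolding C1_on_def charts_at_def
  by (subst frechet_derivative_works[symmetric]) (blast intro: differentiableI)

text \<open>On the overlap of the domains the two coordinate expressions of k differ by the
  transition map, and the overlap has an open image. Both h and the coordinates of a third chart
  serve as k.\<close>

lemma has_derivative_change_chart:
  assumes c: "c \<in> charts_at A p" and c': "c' \<in> charts_at A p"
    and D: "(k \<circ> chart_inv c' has_derivative D) (at (snd c' p))"
  shows "(k \<circ> chart_inv c has_derivative
      D \<circ> frechet_derivative (transition c c') (at (snd c p))) (at (snd c p))"
proof -
  have A: "c \<in> A" "p \<in> fst c" "c' \<in> A" "p \<in> fst c'"
    using c c' by (auto simp: charts_at_def)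
  have "transition c c' (snd c p) = snd c' p"
    using A by (simp add: transition_def chart_inv_chart)
  then have "((k \<circ> chart_inv c') \<circ> transition c c' has_derivative
      D \<circ> frechet_derivative (transition c c') (at (snd c p))) (at (snd c p))"
    using D by (intro diff_chain_at transition_has_derivative c c') simp
  moreover have "open (snd c ` (fst c \<inter> fst c'))"
    using A open_domain[OF A(1)] open_domain[OF A(3)] by (intro open_chart_image) auto
  ultimately show ?thesis
  proof (rule has_derivative_transform_within_open)
    show "snd c p \<in> snd c ` (fst c \<inter> fst c')"
      using A by auto
    fix x assume "x \<in> snd c ` (fst c \<inter> fst c')"
    then show "((k \<circ> chart_inv c') \<circ> transition c c') x = (k \<circ> chart_inv c) x"
      using A by (auto simp: transition_def chart_inv_chart)
  qed
qed

lemma transition_self_derivative: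
  assumes "c \<in> charts_at A p"
  shows "frechet_derivative (transition c c) (at (snd c p)) = id"
proof -
  have A: "c \<in> A" "p \<in> fst c"
    using assms by (auto simp: charts_at_def)
  have "(transition c c has_derivative id) (at (snd c p))"
  proof (rule has_derivative_transform_within_open[OF _ open_range[OF A(1)]])
    show "(id has_derivative id) (at (snd c p))"
      by (simp add: id_def)
    show "id x = transition c c x" if "x \<in> snd c ` fst c" for x
      using that by (simp add: transition_def chart_chart_inv)
  qed (use A in auto)
  then show ?thesis
    by (simp add: frechet_derivative_at[symmetric])
qed

text \<open>The cocycle rule. It is what makes \<open>tangent_of_coords\<close> satisfy the
  transformation law of tangent vectors.\<close>

lemma transition_derivative_compose:
  assumes "c \<in> charts_at A p" "c' \<in> charts_at A p" "c'' \<in> charts_at A p"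
  shows "frechet_derivative (transition c c'') (at (snd c p)) =
    frechet_derivative (transition c' c'') (at (snd c' p)) \<circ>
    frechet_derivative (transition c c') (at (snd c p))"
proof -
  have "(snd c'' \<circ> chart_inv c has_derivative
      frechet_derivative (transition c' c'') (at (snd c' p)) \<circ>
      frechet_derivative (transition c c') (at (snd c p))) (at (snd c p))"
    using transition_has_derivative[OF assms(2,3)]
    by (intro has_derivative_change_chart assms(1,2)) (simp add: transition_def)
  then show ?thesis
    by (metis frechet_derivative_at transition_def)
qed

lemma tangent_of_coords_tangent:
  assumes "c \<in> charts_at A p"
  shows "tangent_of_coords A c p x \<in> tangent_space A p"
  unfolding tangent_space_def
proof (intro CollectI conjI ballI allI impI)
  fix c' c'' assume "c' \<in> charts_at A p" "c'' \<in> charts_at A p"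
  then show "tangent_of_coords A c p x c'' = frechet_derivative (transition c' c'') (at (snd c' p))
      (tangent_of_coords A c p x c')"
    by (simp add: tangent_of_coords_def transition_derivative_compose[OF assms, of c' c''])
qed (simp add: tangent_of_coords_def)

lemma tangent_of_coords_self:
  "c \<in> charts_at A p \<Longrightarrow> tangent_of_coords A c p x c = x"
  by (simp add: tangent_of_coords_def transition_self_derivative)


section \<open>Piecewise C1 paths\<close>

text \<open>Factoring \<gamma> through the chart is legitimate only while \<gamma> stays in its
  domain. By continuity this holds near t, which suffices for the derivative, including the
  one-sided ones at a and b.\<close>

lemma curve_chain_rule:
  assumes "pathin X \<gamma>" "t \<in> {a..b}" "0 \<le> a" "b \<le> 1" and c: "c \<in> charts_at A (\<gamma> t)"
    and w: "(snd c \<circ> \<gamma> has_vector_derivative w) (at t within {a..b})"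
    and D: "(k \<circ> chart_inv c has_derivative D) (at (snd c (\<gamma> t)))"
  shows "(k \<circ> \<gamma> has_vector_derivative D w) (at t within {a..b})"
proof -
  have A: "c \<in> A" "\<gamma> t \<in> fst c"
    using c by (auto simp: charts_at_def)
  obtain e where e: "e > 0" "\<And>s. s \<in> {0..1} \<Longrightarrow> dist s t < e \<Longrightarrow> \<gamma> s \<in> fst c"
    using pathin_near[OF assms(1) open_domain[OF A(1)] _ A(2)] assms by auto
  have "((k \<circ> chart_inv c) \<circ> (snd c \<circ> \<gamma>) has_vector_derivative D w) (at t within {a..b})"
    by (rule vector_derivative_diff_chain_within[OF w], rule has_derivative_at_withinI)
      (use D in \<open>simp add: comp_def\<close>)
  then show ?thesis
    by (rule has_vector_derivative_transform_within[OF _ e(1)])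
      (use assms e A in \<open>auto simp: chart_inv_chart\<close>)
qed

text \<open>\<open>velocity\<close> takes \<open>vector_derivative\<close> separately in each chart,
  a value that is meaningful only where the derivative exists. Differentiability in one chart forces
  it in all charts around the point, with matching values.\<close>

lemma velocity_eq:
  assumes "pathin X \<gamma>" "t \<in> {0..1}" and c: "c \<in> charts_at A (\<gamma> t)"
    and w: "(snd c \<circ> \<gamma> has_vector_derivative w) (at t within {0..1})"
  shows "velocity A \<gamma> t = tangent_of_coords A c (\<gamma> t) w"
proof
  fix c' show "velocity A \<gamma> t c' = tangent_of_coords A c (\<gamma> t) w c'"
  proof (cases "c' \<in> charts_at A (\<gamma> t)")
    case True
    have "(snd c' \<circ> \<gamma> has_vector_derivative
        frechet_derivative (transition c c') (at (snd c (\<gamma> t))) w) (at t within {0..1})"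
      using transition_has_derivative[OF c True]
      by (intro curve_chain_rule[OF assms(1,2) _ _ c w]) (simp_all add: transition_def comp_def)
    then show ?thesis
      using True assms(2) vector_derivative_within_cbox[of 0 1 t]
      by (simp add: velocity_def tangent_of_coords_def)
  qed (simp add: velocity_def tangent_of_coords_def)
qed

lemma C1_curve_on_cong:
  assumes "\<And>t. t \<in> {a..b} \<Longrightarrow> \<gamma> t = \<gamma>' t" "C1_curve_on A a b \<gamma>"
  shows "C1_curve_on A a b \<gamma>'"
  unfolding C1_curve_on_def
proof
  fix c assume "c \<in> A"
  then obtain w where w:
    "\<forall>t\<in>{t \<in> {a..b}. \<gamma> t \<in> fst c}. (snd c \<circ> \<gamma> has_vector_derivative w t) (at t within {a..b})"
    "continuous_on {t \<in> {a..b}. \<gamma> t \<in> fst c} w"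
    using assms(2) unfolding C1_curve_on_def by blast
  have "{t \<in> {a..b}. \<gamma> t \<in> fst c} = {t \<in> {a..b}. \<gamma>' t \<in> fst c}"
    using assms(1) by auto
  moreover have "(snd c \<circ> \<gamma>' has_vector_derivative w t) (at t within {a..b})"
    if "(snd c \<circ> \<gamma> has_vector_derivative w t) (at t within {a..b})" "t \<in> {a..b}" for t
    by (rule has_vector_derivative_transform[OF that(2) _ that(1)]) (use assms(1) in auto)
  ultimately show "\<exists>w. (\<forall>t\<in>{t \<in> {a..b}. \<gamma>' t \<in> fst c}.
      (snd c \<circ> \<gamma>' has_vector_derivative w t) (at t within {a..b})) \<and>
      continuous_on {t \<in> {a..b}. \<gamma>' t \<in> fst c} w"
    using w by auto
qed

text \<open>The factor k may be negative: k = -1 serves reversal, k = 2 the two halves of a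
  concatenation.\<close>

lemma C1_curve_on_affine:
  assumes "C1_curve_on A a b \<gamma>" and sub: "(\<lambda>t. k * t + l) ` {a'..b'} \<subseteq> {a..b}"
  shows "C1_curve_on A a' b' (\<lambda>t. \<gamma> (k * t + l))"
  unfolding C1_curve_on_def
proof
  fix c assume "c \<in> A"
  then obtain w where w:
    "\<And>t. t \<in> {a..b} \<Longrightarrow> \<gamma> t \<in> fst c \<Longrightarrow> (snd c \<circ> \<gamma> has_vector_derivative w t) (at t within {a..b})"
    "continuous_on {t \<in> {a..b}. \<gamma> t \<in> fst c} w"
    using assms(1) unfolding C1_curve_on_def by blast
  show "\<exists>w. (\<forall>t\<in>{t \<in> {a'..b'}. \<gamma> (k * t + l) \<in> fst c}.
      (snd c \<circ> (\<lambda>t. \<gamma> (k * t + l)) has_vector_derivative w t) (at t within {a'..b'})) \<and>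
      continuous_on {t \<in> {a'..b'}. \<gamma> (k * t + l) \<in> fst c} w"
  proof (intro exI[of _ "\<lambda>t. k *\<^sub>R w (k * t + l)"] conjI ballI)
    fix t assume t: "t \<in> {t \<in> {a'..b'}. \<gamma> (k * t + l) \<in> fst c}"
    then have "k * t + l \<in> {a..b}"
      using sub by blast
    then have "(snd c \<circ> \<gamma> has_vector_derivative w (k * t + l))
        (at (k * t + l) within (\<lambda>t. k * t + l) ` {a'..b'})"
      using w(1) t sub by (blast intro: has_vector_derivative_within_subset)
    moreover have "((\<lambda>t. k * t + l) has_vector_derivative k) (at t within {a'..b'})"
      by (auto intro!: derivative_eq_intros)
    ultimately have "((snd c \<circ> \<gamma>) \<circ> (\<lambda>t. k * t + l) has_vector_derivative k *\<^sub>R w (k * t + l))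
        (at t within {a'..b'})"
      by (intro vector_diff_chain_within)
    then show "(snd c \<circ> (\<lambda>t. \<gamma> (k * t + l)) has_vector_derivative k *\<^sub>R w (k * t + l))
        (at t within {a'..b'})"
      by (simp add: comp_def)
  next
    show "continuous_on {t \<in> {a'..b'}. \<gamma> (k * t + l) \<in> fst c} (\<lambda>t. k *\<^sub>R w (k * t + l))"
      by (intro continuous_intros continuous_on_compose2[OF w(2)]) (use sub in force)
  qed
qed

lemma piecewise_C1_path_reverse:
  assumes "piecewise_C1_path X A \<gamma>"
  shows "piecewise_C1_path X A (\<lambda>t. \<gamma> (1 - t))"
  unfolding piecewise_C1_path_def
proof
  obtain S where S: "finite S"
    "\<And>a b. 0 \<le> a \<Longrightarrow> a < b \<Longrightarrow> b \<le> 1 \<Longrightarrow> {a<..<b} \<inter> S = {} \<Longrightarrow> C1_curve_on A a b \<gamma>"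
    using assms by (auto simp: piecewise_C1_path_def)
  have "continuous_map (top_of_set {0..1}) (top_of_set {0..1::real}) (\<lambda>t. 1 - t)"
    by (auto intro!: continuous_intros)
  then have "continuous_map (top_of_set {0..1}) X (\<gamma> \<circ> (\<lambda>t. 1 - t))"
    using assms by (intro continuous_map_compose) (auto simp: piecewise_C1_path_def pathin_def)
  then show "pathin X (\<lambda>t. \<gamma> (1 - t))"
    by (simp add: pathin_def o_def)
  show "\<exists>S. finite S \<and> (\<forall>a b. 0 \<le> a \<and> a < b \<and> b \<le> 1 \<and> {a<..<b} \<inter> S = {} \<longrightarrow>
      C1_curve_on A a b (\<lambda>t. \<gamma> (1 - t)))"
  proof (intro exI[of _ "(\<lambda>t. 1 - t) ` S"] conjI allI impI)
    fix a b :: real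
    assume ab: "0 \<le> a \<and> a < b \<and> b \<le> 1 \<and> {a<..<b} \<inter> (\<lambda>t. 1 - t) ` S = {}"
    have "{1 - b<..<1 - a} \<inter> S = {}"
    proof (rule ccontr)
      assume "{1 - b<..<1 - a} \<inter> S \<noteq> {}"
      then obtain s where "s \<in> S" "1 - b < s" "s < 1 - a"
        by auto
      then have "1 - s \<in> {a<..<b} \<inter> (\<lambda>t. 1 - t) ` S"
        by auto
      then show False
        using ab by blast
    qed
    then have "C1_curve_on A (1 - b) (1 - a) \<gamma>"
      using ab by (intro S(2)) auto
    from C1_curve_on_affine[OF this, of "-1" 1 a b] show "C1_curve_on A a b (\<lambda>t. \<gamma> (1 - t))"
      by auto
  qed (use S in auto)
qed

end

section \<open>Concatenation of paths and connectedness by piecewise C1 paths\<close>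

definition join_paths :: "(real \<Rightarrow> 'a) \<Rightarrow> (real \<Rightarrow> 'a) \<Rightarrow> real \<Rightarrow> 'a" where
  "join_paths \<gamma> \<delta> t = (if t \<le> 1/2 then \<gamma> (2 * t) else \<delta> (2 * t - 1))"

lemma pathin_join_paths:
  assumes "pathin X \<gamma>" "pathin X \<delta>" "\<gamma> 1 = \<delta> 0"
  shows "pathin X (join_paths \<gamma> \<delta>)"
  unfolding pathin_def join_paths_def
proof (rule continuous_map_cases_le)
  have sub: "continuous_map (subtopology (top_of_set {0..1}) T) X (\<mu> \<circ> f)"
    if "continuous_on ({0..1} \<inter> T) f" "f ` ({0..1} \<inter> T) \<subseteq> {0..1}" "pathin X \<mu>"
    for T and f :: "real \<Rightarrow> real" and \<mu>
  proof (rule continuous_map_compose)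
    show "continuous_map (subtopology (top_of_set {0..1}) T) (top_of_set {0..1}) f"
      using that by (auto simp: subtopology_subtopology continuous_map_in_subtopology)
    show "continuous_map (top_of_set {0..1}) X \<mu>"
      using that by (simp add: pathin_def)
  qed
  show "continuous_map (subtopology (top_of_set {0..1})
      {x \<in> topspace (top_of_set {0..1}). x \<le> 1/2}) X (\<lambda>t. \<gamma> (2 * t))"
    using assms by (intro sub[of _ "\<lambda>t. 2 * t" \<gamma>, unfolded o_def]) (auto intro!: continuous_intros)
  show "continuous_map (subtopology (top_of_set {0..1})
      {x \<in> topspace (top_of_set {0..1}). 1/2 \<le> x}) X (\<lambda>t. \<delta> (2 * t - 1))"
    using assms by (intro sub[of _ "\<lambda>t. 2 * t - 1" \<delta>, unfolded o_def]) (auto intro!: continuous_intros)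
qed (use assms in \<open>auto simp: mult.commute\<close>)

context C1_manifold
begin

lemma piecewise_C1_path_join:
  assumes \<gamma>: "piecewise_C1_path X A \<gamma>" and \<delta>: "piecewise_C1_path X A \<delta>" and eq: "\<gamma> 1 = \<delta> 0"
  shows "piecewise_C1_path X A (join_paths \<gamma> \<delta>)"
  unfolding piecewise_C1_path_def
proof
  show "pathin X (join_paths \<gamma> \<delta>)"
    using assms by (simp add: pathin_join_paths piecewise_C1_path_def)
  obtain S where S: "finite S"
    "\<And>a b. 0 \<le> a \<Longrightarrow> a < b \<Longrightarrow> b \<le> 1 \<Longrightarrow> {a<..<b} \<inter> S = {} \<Longrightarrow> C1_curve_on A a b \<gamma>"
    using \<gamma> by (auto simp: piecewise_C1_path_def)
  obtain T where T: "finite T"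
    "\<And>a b. 0 \<le> a \<Longrightarrow> a < b \<Longrightarrow> b \<le> 1 \<Longrightarrow> {a<..<b} \<inter> T = {} \<Longrightarrow> C1_curve_on A a b \<delta>"
    using \<delta> by (auto simp: piecewise_C1_path_def)
  \<comment> \<open>The junction 1/2 becomes a breakpoint, since the velocities of the two pieces
    need not agree there.\<close>
  let ?R = "insert (1/2) ((\<lambda>s. s / 2) ` S \<union> (\<lambda>s. (s + 1) / 2) ` T)"
  show "\<exists>R. finite R \<and> (\<forall>a b. 0 \<le> a \<and> a < b \<and> b \<le> 1 \<and> {a<..<b} \<inter> R = {} \<longrightarrow>
      C1_curve_on A a b (join_paths \<gamma> \<delta>))"
  proof (intro exI[of _ ?R] conjI allI impI)
    fix a b :: real
    assume ab: "0 \<le> a \<and> a < b \<and> b \<le> 1 \<and> {a<..<b} \<inter> ?R = {}"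
    then have "1/2 \<notin> {a<..<b}"
      by blast
    then consider "b \<le> 1/2" | "1/2 \<le> a"
      by fastforce
    then show "C1_curve_on A a b (join_paths \<gamma> \<delta>)"
    proof cases
      case 1
      have "{2 * a<..<2 * b} \<inter> S = {}"
      proof (rule ccontr)
        assume "{2 * a<..<2 * b} \<inter> S \<noteq> {}"
        then obtain s where "s \<in> S" "2 * a < s" "s < 2 * b"
          by auto
        then have "s / 2 \<in> {a<..<b} \<inter> ?R"
          by auto
        then show False
          using ab by blast
      qed
      then have "C1_curve_on A (2 * a) (2 * b) \<gamma>"
        using ab 1 by (intro S(2)) auto
      then have "C1_curve_on A a b (\<lambda>t. \<gamma> (2 * t + 0))"
        by (rule C1_curve_on_affine) auto
      then show ?thesis
        by (rule C1_curve_on_cong[rotated]) (use 1 in \<open>auto simp: join_paths_def\<close>)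
    next
      case 2
      have "{2 * a - 1<..<2 * b - 1} \<inter> T = {}"
      proof (rule ccontr)
        assume "{2 * a - 1<..<2 * b - 1} \<inter> T \<noteq> {}"
        then obtain s where "s \<in> T" "2 * a - 1 < s" "s < 2 * b - 1"
          by auto
        then have "(s + 1) / 2 \<in> {a<..<b} \<inter> ?R"
          by auto
        then show False
          using ab by blast
      qed
      then have "C1_curve_on A (2 * a - 1) (2 * b - 1) \<delta>"
        using ab 2 by (intro T(2)) auto
      then have "C1_curve_on A a b (\<lambda>t. \<delta> (2 * t + -1))"
        by (rule C1_curve_on_affine) auto
      \<comment> \<open>At t = 1/2 the definition takes the branch of \<gamma>; the two branches
        agree there by \<open>eq\<close>.\<close>
      moreover have "\<delta> (2 * t + -1) = join_paths \<gamma> \<delta> t" if "t \<in> {a..b}" for t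
        using that 2 eq by (cases "t = 1/2") (auto simp: join_paths_def mult.commute)
      ultimately show ?thesis
        by (rule C1_curve_on_cong[rotated])
    qed
  qed (use S T in auto)
qed

text \<open>In any other chart the coordinates along the path are a transition map restricted to a
  straight segment, hence C1 without breakpoints.\<close>

lemma piecewise_C1_path_segment:
  assumes c: "c \<in> A" and seg: "closed_segment x y \<subseteq> snd c ` fst c"
  shows "piecewise_C1_path X A (chart_inv c \<circ> linepath x y)"
  unfolding piecewise_C1_path_def
proof
  have "continuous_map (top_of_set {0..1}) (top_of_set (snd c ` fst c)) (linepath x y)"
    using seg linepath_image_01[of x y] by (auto intro!: continuous_intros)
  then show "pathin X (chart_inv c \<circ> linepath x y)"
    unfolding pathin_def by (rule continuous_map_compose) (rule continuous_map_chart_inv[OF c])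
  have in_range: "linepath x y t \<in> snd c ` fst c" if "t \<in> {0..1}" for t
    using seg linepath_in_path[OF that, of x y] by blast
  show "\<exists>S. finite S \<and> (\<forall>a b. 0 \<le> a \<and> a < b \<and> b \<le> 1 \<and> {a<..<b} \<inter> S = {} \<longrightarrow>
      C1_curve_on A a b (chart_inv c \<circ> linepath x y))"
  proof (intro exI[of _ "{}"] conjI allI impI)
    fix a b :: real
    assume ab: "0 \<le> a \<and> a < b \<and> b \<le> 1 \<and> {a<..<b} \<inter> {} = {}"
    show "C1_curve_on A a b (chart_inv c \<circ> linepath x y)"
      unfolding C1_curve_on_def
    proof
      fix c' assume "c' \<in> A"
      let ?I = "{t \<in> {a..b}. (chart_inv c \<circ> linepath x y) t \<in> fst c'}"
      obtain f' where f':
        "\<And>z. z \<in> snd c ` (fst c \<inter> fst c') \<Longrightarrow> (transition c c' has_derivative blinfun_apply (f' z)) (at z)"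
        "continuous_on (snd c ` (fst c \<inter> fst c')) f'"
        using C1_transition[OF c \<open>c' \<in> A\<close>] by (auto simp: C1_on_def)
      have dom: "linepath x y t \<in> snd c ` (fst c \<inter> fst c')" if "t \<in> ?I" for t
        using in_range[of t] that ab
        by (auto intro!: rev_image_eqI[of "chart_inv c (linepath x y t)"] simp: chart_inv_in chart_chart_inv)
      show "\<exists>w. (\<forall>t\<in>?I. (snd c' \<circ> (chart_inv c \<circ> linepath x y) has_vector_derivative w t)
          (at t within {a..b})) \<and> continuous_on ?I w"
      proof (intro exI[of _ "\<lambda>t. blinfun_apply (f' (linepath x y t)) (y - x)"] conjI ballI)
        fix t assume "t \<in> ?I"
        then have "((transition c c' \<circ> linepath x y) has_vector_derivative
            blinfun_apply (f' (linepath x y t)) (y - x)) (at t within {a..b})"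
          using f'(1)[OF dom]
          by (intro vector_derivative_diff_chain_within has_vector_derivative_linepath_within)
             (auto intro: has_derivative_at_withinI)
        then show "(snd c' \<circ> (chart_inv c \<circ> linepath x y) has_vector_derivative
            blinfun_apply (f' (linepath x y t)) (y - x)) (at t within {a..b})"
          by (simp add: transition_def comp_assoc)
      next
        show "continuous_on ?I (\<lambda>t. blinfun_apply (f' (linepath x y t)) (y - x))"
          by (intro continuous_intros continuous_on_compose2[OF f'(2)]) (use dom in auto)
      qed
    qed
  qed auto
qed

text \<open>Radial segments in a coordinate ball join its centre to all its points. Hence the set of
  points reachable from p and its complement are both open, and connectedness leaves only the whole
  space.\<close>

lemma piecewise_C1_path_exists:
  assumes p: "p \<in> topspace X" and q: "q \<in> topspace X"
  obtains \<gamma> where "piecewise_C1_path X A \<gamma>" "\<gamma> 0 = p" "\<gamma> 1 = q"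
proof -
  define R where "R p q \<longleftrightarrow> (\<exists>\<gamma>. piecewise_C1_path X A \<gamma> \<and> \<gamma> 0 = p \<and> \<gamma> 1 = q)" for p q
  have R_sym: "R q p" if "R p q" for p q
    using that piecewise_C1_path_reverse unfolding R_def by force
  have R_trans: "R p r" if pq: "R p q" and qr: "R q r" for p q r
  proof -
    obtain \<gamma> \<delta> where *: "piecewise_C1_path X A \<gamma>" "\<gamma> 0 = p" "\<gamma> 1 = q"
      "piecewise_C1_path X A \<delta>" "\<delta> 0 = q" "\<delta> 1 = r"
      using pq qr by (auto simp: R_def)
    then show ?thesis
      using piecewise_C1_path_join[of \<gamma> \<delta>] unfolding R_def
      by (intro exI[of _ "join_paths \<gamma> \<delta>"]) (auto simp: join_paths_def)
  qed
  have near: "\<exists>W. openin X W \<and> q \<in> W \<and> (\<forall>q'\<in>W. R q q')" if "q \<in> topspace X" for q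
  proof -
    from that obtain c where c: "c \<in> A" "q \<in> fst c"
      by (rule obtain_chart)
    then obtain r where r: "r > 0" "ball (snd c q) r \<subseteq> snd c ` fst c"
      using open_range[OF c(1)] by (auto simp: open_contains_ball)
    have "R q q'" if q': "q' \<in> chart_inv c ` ball (snd c q) r" for q'
    proof -
      obtain y where y: "y \<in> ball (snd c q) r" "q' = chart_inv c y"
        using q' by blast
      have "closed_segment (snd c q) y \<subseteq> ball (snd c q) r"
        using r(1) y(1) by (intro closed_segment_subset) auto
      then have "piecewise_C1_path X A (chart_inv c \<circ> linepath (snd c q) y)"
        using r(2) by (intro piecewise_C1_path_segment c) auto
      then show ?thesis
        unfolding R_def
        by (intro exI[of _ "chart_inv c \<circ> linepath (snd c q) y"])
          (simp add: y c chart_inv_chart linepath_0' linepath_1')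
    qed
    then show ?thesis
      using r c by (intro exI[of _ "chart_inv c ` ball (snd c q) r"])
        (auto intro!: open_chart_inv_image rev_image_eqI[of "snd c q"] simp: chart_inv_chart)
  qed
  define U where "U = {q \<in> topspace X. R p q}"
  have "openin X U"
  proof (subst openin_subopen, intro ballI)
    fix q assume "q \<in> U"
    then obtain W where W: "openin X W" "q \<in> W" "\<forall>q'\<in>W. R q q'" "R p q"
      using near by (auto simp: U_def)
    then have "W \<subseteq> U"
      using openin_subset[OF W(1)] by (auto simp: U_def intro: R_trans)
    then show "\<exists>T. openin X T \<and> q \<in> T \<and> T \<subseteq> U"
      using W by blast
  qed
  moreover have "openin X (topspace X - U)"
  proof (subst openin_subopen, intro ballI)
    fix q assume q: "q \<in> topspace X - U"
    then obtain W where W: "openin X W" "q \<in> W" "\<forall>q'\<in>W. R q q'"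
      using near[of q] by blast
    have "\<not> R p q'" if "q' \<in> W" for q'
      using q R_sym[of q q'] R_trans[of p q' q] that W by (auto simp: U_def)
    then have "W \<subseteq> topspace X - U"
      using openin_subset[OF W(1)] by (auto simp: U_def)
    then show "\<exists>T. openin X T \<and> q \<in> T \<and> T \<subseteq> topspace X - U"
      using W by blast
  qed
  moreover have "p \<in> U"
    using near[OF p] p by (auto simp: U_def)
  ultimately have "U = topspace X"
    using connected connected_space_clopen_in by (auto simp: closedin_def U_def)
  then show thesis
    using q that by (auto simp: U_def R_def)
qed

end

section \<open>Lengths of paths in an isometrically immersed manifold\<close>

locale isometric_immersion = riemannian_manifold X A g
  for X :: "'a topology" and A :: "('a, 'm::finite) chart set" and g +
  fixes h :: "'a \<Rightarrow> real ^ 'n::finite"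
  assumes immersion: "C1_immersion X A h" and isometric: "isometric X A g h"
begin

abbreviation coord_derivative :: "('a, 'm) chart \<Rightarrow> 'a \<Rightarrow> real ^ 'm \<Rightarrow> real ^ 'n" where
  "coord_derivative c p \<equiv> frechet_derivative (h \<circ> chart_inv c) (at (snd c p))"

lemma obtain_C1_derivative:
  assumes "c \<in> A"
  obtains f' where
    "\<And>x. x \<in> snd c ` fst c \<Longrightarrow> (h \<circ> chart_inv c has_derivative blinfun_apply (f' x)) (at x)"
    "continuous_on (snd c ` fst c) f'"
proof -
  have "C1_on (h \<circ> chart_inv c) (snd c ` fst c)"
    using immersion assms by (simp add: C1_immersion_def)
  then show thesis
    using that unfolding C1_on_def by blast
qed

lemma coord_derivative_works:
  assumes "c \<in> charts_at A p"
  shows "(h \<circ> chart_inv c has_derivative coord_derivative c p) (at (snd c p))"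
proof -
  have c: "c \<in> A" "snd c p \<in> snd c ` fst c"
    using assms by (auto simp: charts_at_def)
  show ?thesis
    using obtain_C1_derivative[OF c(1)] c(2)
    by (metis frechet_derivative_works differentiableI)
qed

lemma pushforward_chart:
  assumes c: "c \<in> charts_at A p" and v: "v \<in> tangent_space A p"
  shows "pushforward A h p v = coord_derivative c p (v c)"
proof -
  define c0 where "c0 = (SOME c. c \<in> charts_at A p)"
  have c0: "c0 \<in> charts_at A p"
    using c unfolding c0_def by (metis someI_ex)
  have "coord_derivative c p =
      coord_derivative c0 p \<circ> frechet_derivative (transition c c0) (at (snd c p))"
    using has_derivative_change_chart[OF c c0 coord_derivative_works[OF c0]]
    by (rule frechet_derivative_at[symmetric])
  moreover have "v c0 = frechet_derivative (transition c c0) (at (snd c p)) (v c)"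
    using v c c0 unfolding tangent_space_def by blast
  ultimately show ?thesis
    by (simp add: pushforward_def Let_def flip: c0_def)
qed

lemma pushforward_tangent_of_coords:
  "c \<in> charts_at A p \<Longrightarrow>
    pushforward A h p (tangent_of_coords A c p x) = coord_derivative c p x"
  using pushforward_chart[OF _ tangent_of_coords_tangent] by (simp add: tangent_of_coords_self)

lemma pushforward_tangent_space:
  assumes "c \<in> charts_at A p"
  shows "pushforward A h p ` tangent_space A p = range (coord_derivative c p)"
proof
  show "pushforward A h p ` tangent_space A p \<subseteq> range (coord_derivative c p)"
    using pushforward_chart[OF assms] by auto
  show "range (coord_derivative c p) \<subseteq> pushforward A h p ` tangent_space A p"
    using tangent_of_coords_tangent[OF assms]
    by (auto simp flip: pushforward_tangent_of_coords[OF assms])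
qed

lemma inj_coord_derivative:
  assumes c: "c \<in> charts_at A p"
  shows "inj (coord_derivative c p)"
proof (rule injI)
  fix x y assume "coord_derivative c p x = coord_derivative c p y"
  then have "pushforward A h p (tangent_of_coords A c p x) =
      pushforward A h p (tangent_of_coords A c p y)"
    by (simp add: pushforward_tangent_of_coords[OF c])
  moreover have "p \<in> topspace X"
    using c domain_subset[of c] by (auto simp: charts_at_def)
  then have "inj_on (pushforward A h p) (tangent_space A p)"
    using immersion by (simp add: C1_immersion_def)
  ultimately have "tangent_of_coords A c p x = tangent_of_coords A c p y"
    using tangent_of_coords_tangent[OF c] by (simp add: inj_on_eq_iff)
  then show "x = y"
    by (metis tangent_of_coords_self[OF c])
qed

lemma continuous_map_immersion: "continuous_map X euclidean h"
proof (rule pasting_lemma[where I = A and T = fst and f = "\<lambda>_. h"])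
  fix c assume c: "c \<in> A"
  obtain f' where
    "\<And>x. x \<in> snd c ` fst c \<Longrightarrow> (h \<circ> chart_inv c has_derivative blinfun_apply (f' x)) (at x)"
    using obtain_C1_derivative[OF c] by blast
  then have "continuous_on (snd c ` fst c) (h \<circ> chart_inv c)"
    by (meson continuous_at_imp_continuous_on has_derivative_continuous)
  then have "continuous_map (subtopology X (fst c)) euclidean ((h \<circ> chart_inv c) \<circ> snd c)"
    using homeomorphic_imp_continuous_map[OF homeomorphic[OF c]]
    by (intro continuous_map_compose[where X' = "top_of_set (snd c ` fst c)"]) auto
  then show "continuous_map (subtopology X (fst c)) euclidean h"
    by (rule continuous_map_eq) (auto simp: chart_inv_chart[OF c])
qed (use obtain_chart open_domain in blast)+

lemma continuous_on_path_image:
  "pathin X \<gamma> \<Longrightarrow> continuous_on {0..1} (h \<circ> \<gamma>)"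
  using pathin_compose[OF _ continuous_map_immersion] by (simp add: pathin_def)

text \<open>\<open>C1_curve_on\<close> gives a derivative chart by chart, whereas the derivative of
  the image curve in Euclidean space refers to no chart. The local formulas therefore glue to one
  continuous U.\<close>

lemma C1_curve_image:
  assumes \<gamma>: "pathin X \<gamma>" and ab: "0 \<le> a" "a < b" "b \<le> 1" and C1: "C1_curve_on A a b \<gamma>"
  obtains U where "continuous_on {a..b} U"
    "\<And>t. t \<in> {a..b} \<Longrightarrow> (h \<circ> \<gamma> has_vector_derivative U t) (at t within {a..b})"
proof -
  define U where "U t = vector_derivative (h \<circ> \<gamma>) (at t within {a..b})" for t
  have *: "(h \<circ> \<gamma> has_vector_derivative U t0) (at t0 within {a..b}) \<and> continuous (at t0 within {a..b}) U"
    if t0: "t0 \<in> {a..b}" for t0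
  proof -
    have "\<gamma> t0 \<in> topspace X"
      using path_image_subset_topspace[OF \<gamma>] t0 ab by auto
    then obtain c where c: "c \<in> A" "\<gamma> t0 \<in> fst c"
      by (rule obtain_chart)
    define I where "I = {t \<in> {a..b}. \<gamma> t \<in> fst c}"
    obtain w where w: "\<And>t. t \<in> I \<Longrightarrow> (snd c \<circ> \<gamma> has_vector_derivative w t) (at t within {a..b})"
      and contw: "continuous_on I w"
      using C1 c(1) unfolding C1_curve_on_def I_def by blast
    obtain f' where f': "\<And>x. x \<in> snd c ` fst c \<Longrightarrow>
        (h \<circ> chart_inv c has_derivative blinfun_apply (f' x)) (at x)"
      and contf': "continuous_on (snd c ` fst c) f'"
      using obtain_C1_derivative[OF c(1)] by blast
    define W where "W t = blinfun_apply (f' ((snd c \<circ> \<gamma>) t)) (w t)" for t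
    have der: "(h \<circ> \<gamma> has_vector_derivative W t) (at t within {a..b})" if "t \<in> I" for t
      unfolding W_def using that ab c f'[of "snd c (\<gamma> t)"]
      by (intro curve_chain_rule[OF \<gamma> _ _ _ _ w]) (auto simp: I_def charts_at_def)
    have UW: "U t = W t" if "t \<in> I" for t
      unfolding U_def using der[OF that] that ab
      by (intro vector_derivative_within_cbox[of a b, simplified]) (auto simp: I_def)
    have "continuous_on I (snd c \<circ> \<gamma>)"
    proof (rule continuous_on_eq_continuous_within[THEN iffD2], intro ballI)
      fix t assume "t \<in> I"
      then have "continuous (at t within {a..b}) (snd c \<circ> \<gamma>)"
        using w has_vector_derivative_continuous by blast
      then show "continuous (at t within I) (snd c \<circ> \<gamma>)"
        by (rule continuous_within_subset) (auto simp: I_def)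
    qed
    then have "continuous_on I W"
      unfolding W_def
      by (intro continuous_intros contw continuous_on_compose2[OF contf']) (auto simp: I_def)
    then have "continuous_on I U"
      using UW continuous_on_cong by metis
    then have "continuous (at t0 within I) U"
      using t0 c by (simp add: I_def continuous_on_eq_continuous_within)
    moreover obtain e where "e > 0" "\<And>s. s \<in> {0..1} \<Longrightarrow> dist s t0 < e \<Longrightarrow> \<gamma> s \<in> fst c"
      using pathin_near[OF \<gamma> open_domain[OF c(1)] _ c(2)] t0 ab by auto
    \<comment> \<open>The part of the curve in the chart domain fills a neighbourhood of t0 in the
      interval, so continuity within I is continuity within \<open>{a..b}\<close>.\<close>
    then have "at t0 within I = at t0 within {a..b}"
      using ab by (intro at_within_eq_near) (auto simp: I_def)
    ultimately show ?thesis
      using der[of t0] UW[of t0] t0 c by (simp add: I_def)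
  qed
  show thesis
    by (rule that[of U]) (use * in \<open>auto simp: continuous_on_eq_continuous_within\<close>)
qed

text \<open>Only interior t are considered: there the derivative within \<open>{a..b}\<close>, the
  one within \<open>{0..1}\<close> used by \<open>velocity\<close>, and the two-sided one coincide.
  The speeds agree because the metric is induced by h.\<close>

lemma
  assumes \<gamma>: "pathin X \<gamma>" and ab: "0 \<le> a" "a < t" "t < b" "b \<le> 1"
    and C1: "C1_curve_on A a b \<gamma>"
  shows has_vector_derivative_path_image:
      "(h \<circ> \<gamma> has_vector_derivative pushforward A h (\<gamma> t) (velocity A \<gamma> t)) (at t)"
    and speed_eq: "sqrt (g (\<gamma> t) (velocity A \<gamma> t) (velocity A \<gamma> t)) =
      norm (pushforward A h (\<gamma> t) (velocity A \<gamma> t))"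
proof -
  have at_eq: "at t within {a..b} = at t" "at t within {0..1} = at t"
    using ab by (auto intro!: at_within_interior)
  have p: "\<gamma> t \<in> topspace X"
    using path_image_subset_topspace[OF \<gamma>] ab by auto
  then obtain c where c: "c \<in> A" "\<gamma> t \<in> fst c"
    by (rule obtain_chart)
  then have cp: "c \<in> charts_at A (\<gamma> t)"
    by (simp add: charts_at_def)
  have "t \<in> {t \<in> {a..b}. \<gamma> t \<in> fst c}"
    using ab c by auto
  then obtain w where w: "(snd c \<circ> \<gamma> has_vector_derivative w) (at t within {a..b})"
    using C1 c(1) unfolding C1_curve_on_def by blast
  then have v: "velocity A \<gamma> t = tangent_of_coords A c (\<gamma> t) w"
    using ab at_eq by (intro velocity_eq \<gamma> cp) auto
  have "(h \<circ> \<gamma> has_vector_derivative coord_derivative c (\<gamma> t) w) (at t within {a..b})"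
    using ab by (intro curve_chain_rule[OF \<gamma> _ _ _ cp w coord_derivative_works[OF cp]]) auto
  then show "(h \<circ> \<gamma> has_vector_derivative pushforward A h (\<gamma> t) (velocity A \<gamma> t)) (at t)"
    using at_eq by (simp add: v pushforward_tangent_of_coords[OF cp])
  have "velocity A \<gamma> t \<in> tangent_space A (\<gamma> t)"
    by (simp add: v tangent_of_coords_tangent[OF cp])
  then show "sqrt (g (\<gamma> t) (velocity A \<gamma> t) (velocity A \<gamma> t)) =
      norm (pushforward A h (\<gamma> t) (velocity A \<gamma> t))"
    using isometric p by (simp add: isometric_def norm_eq_sqrt_inner)
qed

end

section \<open>Subdivision of the unit interval at finitely many points\<close>

lemma finite_avoiding_interval:
  fixes t :: real
  assumes "finite S" "t \<in> {0<..<1} - S"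
  obtains a b where "0 \<le> a" "a < t" "t < b" "b \<le> 1" "{a<..<b} \<inter> S = {}"
proof -
  have "open ({0<..<1} - S)"
    using assms(1) by (intro open_Diff finite_imp_closed) auto
  then obtain e where e: "e > 0" "cball t e \<subseteq> {0<..<1} - S"
    using assms(2) open_contains_cball by blast
  then have sub: "{t - e..t + e} \<subseteq> {0<..<1} - S"
    by (simp add: cball_eq_atLeastAtMost)
  have "t - e \<in> {t - e..t + e}" "t + e \<in> {t - e..t + e}"
    using e(1) by auto
  then have "t - e \<in> {0<..<1} - S" "t + e \<in> {0<..<1} - S"
    using sub by blast+
  then show thesis
    using e(1) sub by (intro that[of "t - e" "t + e"]) (auto simp: subset_iff)
qed

text \<open>Induction on the number of points of S inside the open interval: splitting at one of
  them lowers the count on both sides.\<close>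

lemma interval_subdivision_induct:
  fixes a b :: real
  assumes "finite S"
    and free: "\<And>a b. 0 \<le> a \<Longrightarrow> a < b \<Longrightarrow> b \<le> 1 \<Longrightarrow> {a<..<b} \<inter> S = {} \<Longrightarrow> P a b"
    and combine: "\<And>a s b. 0 \<le> a \<Longrightarrow> a < s \<Longrightarrow> s < b \<Longrightarrow> b \<le> 1 \<Longrightarrow> P a s \<Longrightarrow> P s b \<Longrightarrow> P a b"
    and "0 \<le> a" "a < b" "b \<le> 1"
  shows "P a b"
  using assms(4-)
proof (induction "card ({a<..<b} \<inter> S)" arbitrary: a b rule: less_induct)
  case less
  show ?case
  proof (cases "{a<..<b} \<inter> S = {}")
    case False
    then obtain s where s: "s \<in> S" "a < s" "s < b"
      by auto
    then have "{a<..<s} \<inter> S \<subset> {a<..<b} \<inter> S" "{s<..<b} \<inter> S \<subset> {a<..<b} \<inter> S"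
      by auto
    then have "card ({a<..<s} \<inter> S) < card ({a<..<b} \<inter> S)"
      "card ({s<..<b} \<inter> S) < card ({a<..<b} \<inter> S)"
      using \<open>finite S\<close> by (auto intro!: psubset_card_mono)
    then show ?thesis
      using less s by (intro combine[of a s b]) auto
  qed (use less free in auto)
qed

section \<open>Length as the integral of the speed of the image curve\<close>

context isometric_immersion
begin

text \<open>V may be any derivative of the image curve off a finite set. Lengths of constant,
  reversed, joined and straight paths then follow from calculus in Euclidean space, without
  computing velocities in charts.\<close>

lemma has_integral_length:
  assumes \<gamma>: "piecewise_C1_path X A \<gamma>" and "finite R"
    and V: "\<And>t. t \<in> {0<..<1} - R \<Longrightarrow> (h \<circ> \<gamma> has_vector_derivative V t) (at t)"
  shows "((\<lambda>t. norm (V t)) has_integral riemannian_length A g \<gamma>) {0..1}"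
proof -
  have path: "pathin X \<gamma>"
    using \<gamma> by (simp add: piecewise_C1_path_def)
  obtain S where S: "finite S"
    "\<And>a b. 0 \<le> a \<Longrightarrow> a < b \<Longrightarrow> b \<le> 1 \<Longrightarrow> {a<..<b} \<inter> S = {} \<Longrightarrow> C1_curve_on A a b \<gamma>"
    using \<gamma> by (auto simp: piecewise_C1_path_def)
  \<comment> \<open>\<open>integral\<close> returns a default value at a function that is not
    integrable, so integrability comes first: between breakpoints V agrees with a continuous U up to
    finitely many points.\<close>
  have "(\<lambda>t. norm (V t)) integrable_on {0..1}"
  proof (rule interval_subdivision_induct[OF S(1), where P = "\<lambda>a b. (\<lambda>t. norm (V t)) integrable_on {a..b}"])
    fix a b :: real assume ab: "0 \<le> a" "a < b" "b \<le> 1" "{a<..<b} \<inter> S = {}"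
    obtain U where U: "continuous_on {a..b} U"
      "\<And>t. t \<in> {a..b} \<Longrightarrow> (h \<circ> \<gamma> has_vector_derivative U t) (at t within {a..b})"
      using C1_curve_image[OF path ab(1-3) S(2)[OF ab]] by blast
    have UV: "V t = U t" if "t \<in> {a..b} - (R \<union> {a, b})" for t
    proof (rule vector_derivative_unique_at)
      show "(h \<circ> \<gamma> has_vector_derivative V t) (at t)"
        using that ab by (intro V) auto
      show "(h \<circ> \<gamma> has_vector_derivative U t) (at t)"
        using U(2)[of t] that at_within_Icc_at[of a t b] by auto
    qed
    have "(\<lambda>t. norm (U t)) integrable_on {a..b}"
      by (intro integrable_continuous_real continuous_intros U)
    then show "(\<lambda>t. norm (V t)) integrable_on {a..b}"
      by (rule integrable_spike_finite[of "R \<union> {a, b}", rotated 2]) (use UV \<open>finite R\<close> in auto)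
  next
    fix a s b :: real
    assume "a < s" "s < b"
      "(\<lambda>t. norm (V t)) integrable_on {a..s}" "(\<lambda>t. norm (V t)) integrable_on {s..b}"
    then show "(\<lambda>t. norm (V t)) integrable_on {a..b}"
      by (meson Henstock_Kurzweil_Integration.integrable_combine less_imp_le)
  qed auto
  then have "((\<lambda>t. norm (V t)) has_integral integral {0..1} (\<lambda>t. norm (V t))) {0..1}"
    by (rule integrable_integral)
  moreover have "riemannian_length A g \<gamma> = integral {0..1} (\<lambda>t. norm (V t))"
    unfolding riemannian_length_def
  proof (rule integral_spike[of "R \<union> S \<union> {0, 1}"])
    \<comment> \<open>Off R the vector V t is a derivative, off S the path is C1 on an interval
      around t, and away from 0 and 1 such an interval lies on both sides of t.\<close>
    fix t assume t: "t \<in> {0..1} - (R \<union> S \<union> {0, 1})"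
    then obtain a b where ab: "0 \<le> a" "a < t" "t < b" "b \<le> 1" "{a<..<b} \<inter> S = {}"
      using finite_avoiding_interval[OF S(1), of t] by force
    then have C1: "C1_curve_on A a b \<gamma>"
      by (intro S(2)) auto
    have "V t = pushforward A h (\<gamma> t) (velocity A \<gamma> t)"
      using t has_vector_derivative_path_image[OF path ab(1-4) C1]
      by (intro vector_derivative_unique_at[OF V]) auto
    then show "norm (V t) = sqrt (g (\<gamma> t) (velocity A \<gamma> t) (velocity A \<gamma> t))"
      using speed_eq[OF path ab(1-4) C1] by simp
  qed (use S \<open>finite R\<close> in \<open>auto intro: negligible_finite\<close>)
  ultimately show ?thesis
    by simp
qed

lemma obtain_path_derivative:
  assumes \<gamma>: "piecewise_C1_path X A \<gamma>"
  obtains S V where "finite S" "\<And>t. t \<in> {0<..<1} - S \<Longrightarrow> (h \<circ> \<gamma> has_vector_derivative V t) (at t)"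
    "((\<lambda>t. norm (V t)) has_integral riemannian_length A g \<gamma>) {0..1}"
proof -
  have path: "pathin X \<gamma>"
    using \<gamma> by (simp add: piecewise_C1_path_def)
  obtain S where S: "finite S"
    "\<And>a b. 0 \<le> a \<Longrightarrow> a < b \<Longrightarrow> b \<le> 1 \<Longrightarrow> {a<..<b} \<inter> S = {} \<Longrightarrow> C1_curve_on A a b \<gamma>"
    using \<gamma> by (auto simp: piecewise_C1_path_def)
  have V: "(h \<circ> \<gamma> has_vector_derivative pushforward A h (\<gamma> t) (velocity A \<gamma> t)) (at t)"
    if t: "t \<in> {0<..<1} - S" for t
  proof -
    obtain a b where ab: "0 \<le> a" "a < t" "t < b" "b \<le> 1" "{a<..<b} \<inter> S = {}"
      using finite_avoiding_interval[OF S(1) t] by blast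
    then show ?thesis
      by (intro has_vector_derivative_path_image[OF path ab(1-4)] S(2)) auto
  qed
  show thesis
    by (rule that[OF S(1) V has_integral_length[OF \<gamma> S(1) V]])
qed

text \<open>A chord is no longer than its arc. Intermediate t are allowed because positivity of the
  distance evaluates the bound where a path crosses a coordinate sphere.\<close>

lemma dist_le_length:
  assumes \<gamma>: "piecewise_C1_path X A \<gamma>" and t: "t \<in> {0..1}"
  shows "dist (h (\<gamma> 0)) (h (\<gamma> t)) \<le> riemannian_length A g \<gamma>"
proof -
  have path: "pathin X \<gamma>"
    using \<gamma> by (simp add: piecewise_C1_path_def)
  obtain S V where S: "finite S"
    and V: "\<And>t. t \<in> {0<..<1} - S \<Longrightarrow> (h \<circ> \<gamma> has_vector_derivative V t) (at t)"
    and L: "((\<lambda>t. norm (V t)) has_integral riemannian_length A g \<gamma>) {0..1}"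
    using obtain_path_derivative[OF \<gamma>] by metis
  have "(V has_integral (h \<circ> \<gamma>) t - (h \<circ> \<gamma>) 0) {0..t}"
  proof (rule fundamental_theorem_of_calculus_interior_strong[OF S])
    show "(h \<circ> \<gamma> has_vector_derivative V s) (at s)" if "s \<in> {0<..<t} - S" for s
      using that t by (intro V) auto
    show "continuous_on {0..t} (h \<circ> \<gamma>)"
      using t by (intro continuous_on_subset[OF continuous_on_path_image[OF path]]) auto
  qed (use t in auto)
  moreover have "(\<lambda>t. norm (V t)) integrable_on {0..t}"
    using L t by (meson has_integral_integrable integrable_on_subinterval atLeastatMost_subset_iff
        atLeastAtMost_iff order_refl)
  ultimately have "norm ((h \<circ> \<gamma>) t - (h \<circ> \<gamma>) 0) \<le> integral {0..t} (\<lambda>t. norm (V t))"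
    by (metis has_integral_integrable_integral integral_norm_bound_integral order_refl)
  also have "\<dots> \<le> integral {0..1} (\<lambda>t. norm (V t))"
    using L t \<open>(\<lambda>t. norm (V t)) integrable_on {0..t}\<close>
    by (intro integral_subset_le) (auto simp: has_integral_integrable)
  also have "\<dots> = riemannian_length A g \<gamma>"
    using L by (rule integral_unique)
  finally show ?thesis
    by (simp add: dist_norm norm_minus_commute)
qed

lemma length_nonneg: "piecewise_C1_path X A \<gamma> \<Longrightarrow> riemannian_length A g \<gamma> \<ge> 0"
  using dist_le_length[of \<gamma> 0] by simp

lemma length_const:
  assumes "p \<in> topspace X"
  shows "piecewise_C1_path X A (\<lambda>t. p)" "riemannian_length A g (\<lambda>t. p) = 0"
proof -
  show path: "piecewise_C1_path X A (\<lambda>t. p)"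
    unfolding piecewise_C1_path_def C1_curve_on_def
    using assms by (auto simp: comp_def intro!: exI[of _ "{}"] exI[of _ "\<lambda>_. 0"])
  have "((\<lambda>t::real. norm (0 :: real ^ 'n)) has_integral riemannian_length A g (\<lambda>t. p)) {0..1}"
    by (rule has_integral_length[OF path, of "{}"]) (auto simp: comp_def)
  then show "riemannian_length A g (\<lambda>t. p) = 0"
    using has_integral_unique has_integral_0 by fastforce
qed

lemma length_reverse:
  assumes \<gamma>: "piecewise_C1_path X A \<gamma>"
  shows "riemannian_length A g (\<lambda>t. \<gamma> (1 - t)) = riemannian_length A g \<gamma>"
proof -
  obtain S V where S: "finite S"
    and V: "\<And>t. t \<in> {0<..<1} - S \<Longrightarrow> (h \<circ> \<gamma> has_vector_derivative V t) (at t)"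
    and L: "((\<lambda>t. norm (V t)) has_integral riemannian_length A g \<gamma>) {0..1}"
    using obtain_path_derivative[OF \<gamma>] by metis
  have "((\<lambda>t. norm (- V (1 - t))) has_integral riemannian_length A g (\<lambda>t. \<gamma> (1 - t))) {0..1}"
  proof (rule has_integral_length[OF piecewise_C1_path_reverse[OF \<gamma>], of "(\<lambda>t. 1 - t) ` S"])
    fix t :: real assume t: "t \<in> {0<..<1} - (\<lambda>t. 1 - t) ` S"
    then have "1 - t \<in> {0<..<1} - S"
      by (auto simp: image_iff)
    then have "(h \<circ> \<gamma> has_vector_derivative V (1 - t)) (at (1 - t))"
      by (rule V)
    moreover have "((\<lambda>t. 1 - t) has_vector_derivative -1) (at t)"
      by (auto intro!: derivative_eq_intros)
    ultimately have "((h \<circ> \<gamma>) \<circ> (\<lambda>t. 1 - t) has_vector_derivative -1 *\<^sub>R V (1 - t)) (at t)"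
      by (intro vector_diff_chain_at)
    then show "(h \<circ> (\<lambda>t. \<gamma> (1 - t)) has_vector_derivative - V (1 - t)) (at t)"
      by (simp add: comp_def)
  qed (use S in auto)
  moreover have "((\<lambda>t. norm (V (-1 *\<^sub>R t + 1))) has_integral
      (1 / \<bar>-1\<bar> ^ DIM(real)) *\<^sub>R riemannian_length A g \<gamma>)
      ((\<lambda>t. (1 / -1) *\<^sub>R t + - ((1 / -1) *\<^sub>R 1)) ` cbox 0 1)"
    using L by (intro has_integral_affinity) auto
  then have "((\<lambda>t. norm (- V (1 - t))) has_integral riemannian_length A g \<gamma>) {0..1}"
    by simp
  ultimately show ?thesis
    by (rule has_integral_unique)
qed

lemma length_join:
  assumes \<gamma>: "piecewise_C1_path X A \<gamma>" and \<delta>: "piecewise_C1_path X A \<delta>" and eq: "\<gamma> 1 = \<delta> 0"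
  shows "riemannian_length A g (join_paths \<gamma> \<delta>) = riemannian_length A g \<gamma> + riemannian_length A g \<delta>"
proof -
  obtain S V where S: "finite S"
    and V: "\<And>t. t \<in> {0<..<1} - S \<Longrightarrow> (h \<circ> \<gamma> has_vector_derivative V t) (at t)"
    and L\<gamma>: "((\<lambda>t. norm (V t)) has_integral riemannian_length A g \<gamma>) {0..1}"
    using obtain_path_derivative[OF \<gamma>] by metis
  obtain T W where T: "finite T"
    and W: "\<And>t. t \<in> {0<..<1} - T \<Longrightarrow> (h \<circ> \<delta> has_vector_derivative W t) (at t)"
    and L\<delta>: "((\<lambda>t. norm (W t)) has_integral riemannian_length A g \<delta>) {0..1}"
    using obtain_path_derivative[OF \<delta>] by metis
  define U where "U t = (if t < 1/2 then 2 *\<^sub>R V (2 * t) else 2 *\<^sub>R W (2 * t - 1))" for t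
  let ?R = "insert (1/2) ((\<lambda>s. s / 2) ` S \<union> (\<lambda>s. (s + 1) / 2) ` T)"
  have "((\<lambda>t. norm (U t)) has_integral riemannian_length A g (join_paths \<gamma> \<delta>)) {0..1}"
  proof (rule has_integral_length[OF piecewise_C1_path_join[OF assms], of ?R])
    fix t :: real assume t: "t \<in> {0<..<1} - ?R"
    then consider "t < 1/2" | "1/2 < t"
      by fastforce
    then show "(h \<circ> join_paths \<gamma> \<delta> has_vector_derivative U t) (at t)"
    proof cases
      case 1
      then have "2 * t \<in> {0<..<1} - S"
        using t by (auto simp: image_iff mult.commute)
      moreover have "((\<lambda>t. 2 * t) has_vector_derivative 2) (at t)"
        by (auto intro!: derivative_eq_intros)
      ultimately have "((h \<circ> \<gamma>) \<circ> (\<lambda>t. 2 * t) has_vector_derivative 2 *\<^sub>R V (2 * t)) (at t)"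
        using V by (intro vector_diff_chain_at)
      then have "((h \<circ> \<gamma>) \<circ> (\<lambda>t. 2 * t) has_vector_derivative U t) (at t)"
        using 1 by (simp add: U_def)
      then show ?thesis
        by (rule has_vector_derivative_transform_within_open[of _ _ _ "{..<1/2}"])
          (use 1 in \<open>auto simp: join_paths_def\<close>)
    next
      case 2
      then have "2 * t - 1 \<in> {0<..<1} - T"
        using t by (force simp: image_iff)
      moreover have "((\<lambda>t. 2 * t - 1) has_vector_derivative 2) (at t)"
        by (auto intro!: derivative_eq_intros)
      ultimately have "((h \<circ> \<delta>) \<circ> (\<lambda>t. 2 * t - 1) has_vector_derivative 2 *\<^sub>R W (2 * t - 1)) (at t)"
        using W by (intro vector_diff_chain_at)
      then have "((h \<circ> \<delta>) \<circ> (\<lambda>t. 2 * t - 1) has_vector_derivative U t) (at t)"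
        using 2 by (simp add: U_def)
      then show ?thesis
        by (rule has_vector_derivative_transform_within_open[of _ _ _ "{1/2<..}"])
          (use 2 in \<open>auto simp: join_paths_def\<close>)
    qed
  qed (use S T in auto)
  moreover have "((\<lambda>t. norm (U t)) has_integral riemannian_length A g \<gamma> + riemannian_length A g \<delta>) {0..1}"
  proof (rule has_integral_combine[of 0 "1/2" 1])
    \<comment> \<open>Doubled speed on an interval of half the length: the factor 2 cancels the one
      from the substitution.\<close>
    have "((\<lambda>t. 2 * norm (V (2 *\<^sub>R t + 0))) has_integral 2 * (riemannian_length A g \<gamma> /\<^sub>R 2 ^ DIM(real)))
        (cbox ((0 - 0) /\<^sub>R 2) ((1 - 0) /\<^sub>R 2))"
      using L\<gamma> by (intro has_integral_mult_right has_integral_affinity') auto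
    then have "((\<lambda>t. 2 * norm (V (2 * t))) has_integral riemannian_length A g \<gamma>) {0..1/2}"
      by simp
    then show "((\<lambda>t. norm (U t)) has_integral riemannian_length A g \<gamma>) {0..1/2}"
      by (rule has_integral_spike_finite[of "{1/2}", rotated 2]) (auto simp: U_def)
    have "((\<lambda>t. 2 * norm (W (2 *\<^sub>R t + -1))) has_integral 2 * (riemannian_length A g \<delta> /\<^sub>R 2 ^ DIM(real)))
        (cbox ((0 - -1) /\<^sub>R 2) ((1 - -1) /\<^sub>R 2))"
      using L\<delta> by (intro has_integral_mult_right has_integral_affinity') auto
    then have "((\<lambda>t. 2 * norm (W (2 * t - 1))) has_integral riemannian_length A g \<delta>) {1/2..1}"
      by simp
    then show "((\<lambda>t. norm (U t)) has_integral riemannian_length A g \<delta>) {1/2..1}"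
      by (rule has_integral_spike_finite[of "{}", rotated 2]) (auto simp: U_def)
  qed auto
  ultimately show ?thesis
    by (rule has_integral_unique)
qed

end

section \<open>The Riemannian distance\<close>

context isometric_immersion
begin

abbreviation rdist where "rdist \<equiv> riemannian_dist X A g"

lemma rdist_le_length:
  assumes \<gamma>: "piecewise_C1_path X A \<gamma>"
  shows "rdist (\<gamma> 0) (\<gamma> 1) \<le> riemannian_length A g \<gamma>"
proof -
  have "\<gamma> 0 \<in> topspace X" "\<gamma> 1 \<in> topspace X"
    using \<gamma> path_start_in_topspace path_finish_in_topspace by (auto simp: piecewise_C1_path_def)
  moreover have "bdd_below (riemannian_length A g ` {\<delta>. piecewise_C1_path X A \<delta> \<and> \<delta> 0 = \<gamma> 0 \<and> \<delta> 1 = \<gamma> 1})"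
    using length_nonneg by (intro bdd_belowI2[of _ 0]) auto
  ultimately show ?thesis
    using \<gamma> by (auto simp: riemannian_dist_def intro!: cInf_lower)
qed

text \<open>The set of connecting paths must be nonempty, as the infimum of an empty set of reals is
  an arbitrary value; the existence of piecewise C1 paths enters here.\<close>

lemma le_rdistI:
  assumes "p \<in> topspace X" "q \<in> topspace X"
    and "\<And>\<gamma>. piecewise_C1_path X A \<gamma> \<Longrightarrow> \<gamma> 0 = p \<Longrightarrow> \<gamma> 1 = q \<Longrightarrow> l \<le> riemannian_length A g \<gamma>"
  shows "l \<le> rdist p q"
proof -
  obtain \<gamma> where "piecewise_C1_path X A \<gamma>" "\<gamma> 0 = p" "\<gamma> 1 = q"
    using piecewise_C1_path_exists[OF assms(1,2)] by blast
  then have "{\<gamma>. piecewise_C1_path X A \<gamma> \<and> \<gamma> 0 = p \<and> \<gamma> 1 = q} \<noteq> {}"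
    by blast
  then show ?thesis
    using assms by (auto simp: riemannian_dist_def intro!: cInf_greatest)
qed

lemma dist_le_rdist:
  assumes "p \<in> topspace X" "q \<in> topspace X"
  shows "dist (h p) (h q) \<le> rdist p q"
  using dist_le_length[of _ 1] by (intro le_rdistI assms) auto

lemma rdist_commute: "rdist p q = rdist q p"
proof -
  have le: "rdist q p \<le> rdist p q" if "p \<in> topspace X" "q \<in> topspace X" for p q
  proof (rule le_rdistI[OF that])
    fix \<gamma> assume "piecewise_C1_path X A \<gamma>" "\<gamma> 0 = p" "\<gamma> 1 = q"
    then show "rdist q p \<le> riemannian_length A g \<gamma>"
      using rdist_le_length[OF piecewise_C1_path_reverse, of \<gamma>] by (simp add: length_reverse)
  qed
  show ?thesis
    using le[of p q] le[of q p] by (auto simp: riemannian_dist_def)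
qed

text \<open>The two infima are taken one after the other, with the remaining terms moved to the left
  side; paths are joined in the inner step.\<close>

lemma rdist_triangle:
  assumes p: "p \<in> topspace X" and q: "q \<in> topspace X" and r: "r \<in> topspace X"
  shows "rdist p r \<le> rdist p q + rdist q r"
proof -
  have "rdist p r - rdist p q \<le> rdist q r"
  proof (rule le_rdistI[OF q r])
    fix \<delta> assume \<delta>: "piecewise_C1_path X A \<delta>" "\<delta> 0 = q" "\<delta> 1 = r"
    have "rdist p r - riemannian_length A g \<delta> \<le> rdist p q"
    proof (rule le_rdistI[OF p q])
      fix \<gamma> assume \<gamma>: "piecewise_C1_path X A \<gamma>" "\<gamma> 0 = p" "\<gamma> 1 = q"
      then show "rdist p r - riemannian_length A g \<delta> \<le> riemannian_length A g \<gamma>"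
        using \<delta> rdist_le_length[OF piecewise_C1_path_join[of \<gamma> \<delta>]] length_join[of \<gamma> \<delta>]
        by (simp add: join_paths_def)
    qed
    then show "rdist p r - rdist p q \<le> riemannian_length A g \<delta>"
      by simp
  qed
  then show ?thesis
    by simp
qed

text \<open>The immersion need not be injective, so the distance of its values does not separate points.
  On a small chart ball around \<open>p\<close> it does stay away from \<open>h p\<close> at a linear rate, and a path from
  \<open>p\<close> to \<open>q\<close> crosses the boundary of each such ball that does not contain \<open>q\<close>.\<close>

lemma rdist_pos:
  assumes p: "p \<in> topspace X" and q: "q \<in> topspace X" and "p \<noteq> q"
  shows "rdist p q > 0"
proof -
  obtain c where c: "c \<in> A" "p \<in> fst c"
    using p by (rule obtain_chart)
  then have cp: "c \<in> charts_at A p"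
    by (simp add: charts_at_def)
  let ?x = "snd c p"
  have der: "(h \<circ> chart_inv c has_derivative coord_derivative c p) (at ?x)"
    by (rule coord_derivative_works[OF cp])
  \<comment> \<open>B is the linear growth rate of the injective differential. Within
    \<open>r1\<close> the remainder costs at most half of it, which leaves the rate B / 2 for h
    itself.\<close>
  obtain B where B: "B > 0" "\<And>v. B * norm v \<le> norm (coord_derivative c p v)"
    using linear_inj_bounded_below_pos[OF has_derivative_linear[OF der] inj_coord_derivative[OF cp]]
    by blast
  then obtain r1 where r1: "r1 > 0" "\<And>y. norm (y - ?x) < r1 \<Longrightarrow>
      norm ((h \<circ> chart_inv c) y - (h \<circ> chart_inv c) ?x - coord_derivative c p (y - ?x))
        \<le> B / 2 * norm (y - ?x)"
    using der[unfolded has_derivative_at_alt] by (metis half_gt_zero)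
  obtain r2 where r2: "r2 > 0" "cball ?x r2 \<subseteq> snd c ` fst c"
    using open_range[OF c(1)] c(2) by (auto simp: open_contains_cball)
  \<comment> \<open>Keeps q out of the closed coordinate ball of radius r. If q is not in the domain
    of c, it is outside in any case and the value 1 is arbitrary.\<close>
  define r3 where "r3 = (if q \<in> fst c then norm (snd c q - ?x) else 1)"
  have "r3 > 0"
    using \<open>p \<noteq> q\<close> chart_inv_chart[OF c(1)] c(2) by (auto simp: r3_def) metis
  define r where "r = min (r1 / 2) (min r2 (r3 / 2))"
  have r: "r > 0" "r < r1" "r \<le> r2" "r < r3"
    using \<open>r3 > 0\<close> r1 r2 by (auto simp: r_def min_def)
  have ball: "cball ?x r \<subseteq> snd c ` fst c"
    using r(3) r2(2) by (meson cball_subset_cball_iff dist_self order_trans subset_cball)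
  have "B / 2 * r \<le> rdist p q"
  proof (rule le_rdistI[OF p q])
    fix \<gamma> assume \<gamma>: "piecewise_C1_path X A \<gamma>" "\<gamma> 0 = p" "\<gamma> 1 = q"
    then have path: "pathin X \<gamma>"
      by (simp add: piecewise_C1_path_def)
    define K where "K = chart_inv c ` cball ?x r"
    define V where "V = chart_inv c ` ball ?x r"
    have "openin X V"
      unfolding V_def using ball ball_subset_cball by (intro open_chart_inv_image c) blast+
    \<comment> \<open>Compactness of K gives closedness only because X is Hausdorff; otherwise a
      path could leave K without crossing the coordinate sphere.\<close>
    moreover have "closedin X K"
    proof (rule compactin_imp_closedin[OF Hausdorff])
      have "compactin (top_of_set (snd c ` fst c)) (cball ?x r)"
        using ball by (simp add: compactin_subtopology)
      then show "compactin X K"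
        unfolding K_def by (rule image_compactin) (rule continuous_map_chart_inv[OF c(1)])
    qed
    ultimately have "openin X V" "openin X (topspace X - K)"
      by auto
    moreover have "p \<in> V"
      unfolding V_def by (rule rev_image_eqI[of ?x]) (use r c in \<open>auto simp: chart_inv_chart\<close>)
    moreover have "q \<notin> K"
    proof
      assume "q \<in> K"
      then obtain y where y: "y \<in> cball ?x r" "q = chart_inv c y"
        by (auto simp: K_def)
      then have "q \<in> fst c" "snd c q = y"
        using ball chart_inv_in[of y c] chart_chart_inv[of y c] by auto
      then show False
        using y r(4) by (simp add: r3_def dist_norm norm_minus_commute)
    qed
    moreover have "V \<subseteq> K"
      unfolding V_def K_def by (intro image_mono ball_subset_cball)
    \<comment> \<open>V and the complement of K are disjoint open sets that contain p and q
      respectively, so the connected image of the path meets K outside V.\<close>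
    ultimately have "\<not> \<gamma> ` {0..1} \<subseteq> V \<union> (topspace X - K)"
      using connectedin_path_image[OF path] q \<gamma>(2,3) unfolding connectedin
      by (smt (verit) DiffI Diff_iff Int_iff atLeastAtMost_iff disjoint_iff empty_iff image_eqI subset_iff)
    moreover have "\<gamma> ` {0..1} \<subseteq> topspace X"
      using path_image_subset_topspace[OF path] by auto
    ultimately obtain t where t: "t \<in> {0..1}" "\<gamma> t \<in> K" "\<gamma> t \<notin> V"
      by blast
    then obtain y where y: "y \<in> cball ?x r" "\<gamma> t = chart_inv c y"
      by (auto simp: K_def)
    then have "y \<notin> ball ?x r"
      using t(3) by (auto simp: V_def)
    then have ny: "norm (y - ?x) = r"
      using y(1) by (auto simp: dist_norm norm_minus_commute)
    have "B * r \<le> norm (coord_derivative c p (y - ?x))"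
      using B(2)[of "y - ?x"] ny by simp
    also have "\<dots> \<le> norm ((h \<circ> chart_inv c) y - (h \<circ> chart_inv c) ?x) + B / 2 * r"
      using r1(2)[of y] ny r(2)
        norm_triangle_ineq4[of "(h \<circ> chart_inv c) y - (h \<circ> chart_inv c) ?x"
          "(h \<circ> chart_inv c) y - (h \<circ> chart_inv c) ?x - coord_derivative c p (y - ?x)"]
      by simp
    finally have "B / 2 * r \<le> dist (h (\<gamma> 0)) (h (\<gamma> t))"
      using y(2) c \<gamma>(2) by (simp add: chart_inv_chart dist_norm norm_minus_commute)
    then show "B / 2 * r \<le> riemannian_length A g \<gamma>"
      using dist_le_length[OF \<gamma>(1) t(1)] by simp
  qed
  then show ?thesis
    using B(1) r(1) by (smt (verit) half_gt_zero mult_pos_pos)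
qed

lemma rdist_refl: "rdist p p = 0"
proof (cases "p \<in> topspace X")
  case True
  then show ?thesis
    using rdist_le_length[OF length_const(1)[OF True]] length_const(2)[OF True] dist_le_rdist[OF True True]
    by simp
qed (simp add: riemannian_dist_def)

sublocale Metric_space "topspace X" rdist
proof
  show "0 \<le> rdist p q" for p q
  proof (cases "p \<in> topspace X \<and> q \<in> topspace X")
    case True
    then show ?thesis
      using dist_le_rdist[of p q] zero_le_dist order_trans by blast
  qed (auto simp: riemannian_dist_def)
  show "rdist p q = 0 \<longleftrightarrow> p = q" if "p \<in> topspace X" "q \<in> topspace X" for p q
    using rdist_pos[OF that] rdist_refl by force
qed (fact rdist_commute rdist_triangle)+

lemma mspace_riemannian_metric: "mspace (riemannian_metric X A g) = topspace X"
  and mdist_riemannian_metric: "mdist (riemannian_metric X A g) = rdist"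
  by (simp_all add: riemannian_metric_def)

text \<open>Ekeland's principle asks for continuity in the topology of the distance. It holds
  because h does not increase distances, without comparing that topology with X.\<close>

lemma continuous_map_inner_immersion:
  "continuous_map mtopology euclideanreal (\<lambda>q. \<nu> \<bullet> h q)"
proof -
  have "\<bar>\<nu> \<bullet> h p - \<nu> \<bullet> h q\<bar> \<le> norm \<nu> * rdist p q" if "p \<in> topspace X" "q \<in> topspace X" for p q
    using Cauchy_Schwarz_ineq2[of \<nu> "h p - h q"] mult_left_mono[OF dist_le_rdist[OF that] norm_ge_zero[of \<nu>]]
    by (simp add: inner_diff_right dist_norm)
  then have "Lipschitz_continuous_map (metric (topspace X, rdist)) euclidean_metric (\<lambda>q. \<nu> \<bullet> h q)"
    unfolding Lipschitz_continuous_map_def by (auto simp: dist_real_def)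
  then show ?thesis
    using Lipschitz_continuous_imp_continuous_map by (fastforce simp: mtopology_of_def)
qed


section \<open>Almost critical points\<close>

text \<open>The segment of parameter length \<open>\<tau>\<close> that leaves \<open>z\<close> in a chart with velocity \<open>w\<close> has length at most
  \<open>\<tau> (norm w + \<eta>)\<close> for small \<open>\<tau>\<close>, which bounds the distance from above without geodesics.\<close>

lemma inner_tangent_le:
  assumes z: "z \<in> topspace X" and "e \<ge> 0"
    and le: "\<And>y. y \<in> topspace X \<Longrightarrow> \<nu> \<bullet> h y \<le> \<nu> \<bullet> h z + e * rdist z y"
    and w: "w \<in> pushforward A h z ` tangent_space A z"
  shows "\<nu> \<bullet> w \<le> e * norm w"
proof -
  obtain c where c: "c \<in> A" "z \<in> fst c"
    using z by (rule obtain_chart)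
  then have cz: "c \<in> charts_at A z"
    by (simp add: charts_at_def)
  let ?x = "snd c z"
  let ?\<phi> = "h \<circ> chart_inv c"
  have x: "?x \<in> snd c ` fst c"
    using c(2) by blast
  obtain v where v: "w = coord_derivative c z v"
    using w by (auto simp: pushforward_tangent_space[OF cz])
  obtain f' where f': "\<And>y. y \<in> snd c ` fst c \<Longrightarrow> (?\<phi> has_derivative blinfun_apply (f' y)) (at y)"
    and contf': "continuous_on (snd c ` fst c) f'"
    using obtain_C1_derivative[OF c(1)] by blast
  have w_eq: "w = blinfun_apply (f' ?x) v"
    using f'[OF x] v by (simp add: frechet_derivative_at[symmetric])
  \<comment> \<open>The slack \<eta> absorbs the variation of the differential along a short
    coordinate segment, whose image has a speed only close to \<tau> times the norm of w.\<close>
  have "\<nu> \<bullet> w \<le> e * (norm w + \<eta>)" if "\<eta> > 0" for \<eta>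
  proof -
    have "continuous_on (snd c ` fst c) (\<lambda>y. blinfun_apply (f' y) v)"
      by (intro continuous_intros contf')
    then have "isCont (\<lambda>y. blinfun_apply (f' y) v) ?x"
      using x open_range[OF c(1)] continuous_on_eq_continuous_at by blast
    then obtain r1 where r1: "r1 > 0"
      "\<And>y. dist y ?x < r1 \<Longrightarrow> dist (blinfun_apply (f' y) v) w < \<eta>"
      using \<open>\<eta> > 0\<close> unfolding continuous_at_eps_delta w_eq by blast
    obtain r2 where r2: "r2 > 0" "ball ?x r2 \<subseteq> snd c ` fst c"
      using open_range[OF c(1)] x by (auto simp: open_contains_ball)
    define r where "r = min r1 r2"
    have r: "r > 0" "r \<le> r1" "ball ?x r \<subseteq> snd c ` fst c"
      using r1 r2 by (auto simp: r_def)
    have bound: "\<nu> \<bullet> (?\<phi> (?x + \<tau> *\<^sub>R v) - ?\<phi> ?x) \<le> e * (\<tau> * (norm w + \<eta>))"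
      if \<tau>: "\<tau> > 0" "\<tau> * norm v < r" for \<tau>
    proof -
      let ?y = "?x + \<tau> *\<^sub>R v"
      let ?\<gamma> = "chart_inv c \<circ> linepath ?x ?y"
      have "?y \<in> ball ?x r"
        using \<tau> by (simp add: dist_norm)
      then have seg: "closed_segment ?x ?y \<subseteq> ball ?x r"
        using r(1) by (intro closed_segment_subset) auto
      have path: "piecewise_C1_path X A ?\<gamma>"
        using seg r(3) by (intro piecewise_C1_path_segment c) auto
      have line: "linepath ?x ?y t \<in> ball ?x r" if "t \<in> {0..1}" for t
        using seg linepath_in_path[OF that, of ?x ?y] by blast
      have "((\<lambda>t. norm (blinfun_apply (f' (linepath ?x ?y t)) (?y - ?x))) has_integral
          riemannian_length A g ?\<gamma>) {0..1}"
      proof (rule has_integral_length[OF path, of "{}"])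
        fix t :: real assume "t \<in> {0<..<1} - {}"
        then have "linepath ?x ?y t \<in> snd c ` fst c"
          using line[of t] r(3) by auto
        then have "(?\<phi> \<circ> linepath ?x ?y has_vector_derivative
            blinfun_apply (f' (linepath ?x ?y t)) (?y - ?x)) (at t)"
          using f'
          by (intro vector_derivative_diff_chain_within has_vector_derivative_linepath_within)
             (blast intro: has_derivative_at_withinI)
        then show "(h \<circ> ?\<gamma> has_vector_derivative
            blinfun_apply (f' (linepath ?x ?y t)) (?y - ?x)) (at t)"
          by (simp add: comp_assoc)
      qed auto
      moreover have "((\<lambda>t::real. \<tau> * (norm w + \<eta>)) has_integral \<tau> * (norm w + \<eta>)) {0..1}"
        using has_integral_const_real[of "\<tau> * (norm w + \<eta>)" 0 1] by simp
      moreover have "norm (blinfun_apply (f' (linepath ?x ?y t)) (?y - ?x)) \<le> \<tau> * (norm w + \<eta>)"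
        if "t \<in> {0..1}" for t
      proof -
        have "dist (blinfun_apply (f' (linepath ?x ?y t)) v) w < \<eta>"
          using line[OF that] r(2) by (intro r1) (auto simp: dist_commute)
        then have "norm (blinfun_apply (f' (linepath ?x ?y t)) v) \<le> norm w + \<eta>"
          using norm_triangle_sub[of "blinfun_apply (f' (linepath ?x ?y t)) v" w]
          by (simp add: dist_norm)
        then show ?thesis
          using \<tau>(1) by (simp add: blinfun.scaleR_right)
      qed
      ultimately have "riemannian_length A g ?\<gamma> \<le> \<tau> * (norm w + \<eta>)"
        by (rule has_integral_le)
      moreover have ends: "?\<gamma> 0 = z" "?\<gamma> 1 = chart_inv c ?y"
        by (simp_all add: c chart_inv_chart linepath_0' linepath_1')
      ultimately have "rdist z (chart_inv c ?y) \<le> \<tau> * (norm w + \<eta>)"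
        using rdist_le_length[OF path] unfolding ends by linarith
      moreover have "chart_inv c ?y \<in> topspace X"
        using \<open>?y \<in> ball ?x r\<close> r(3) chart_inv_in[of ?y c] domain_subset[OF c(1)] by blast
      ultimately have "\<nu> \<bullet> h (chart_inv c ?y) \<le> \<nu> \<bullet> h z + e * (\<tau> * (norm w + \<eta>))"
        using le mult_left_mono[OF _ \<open>e \<ge> 0\<close>] by fastforce
      then show ?thesis
        by (simp add: inner_diff_right c chart_inv_chart)
    qed
    have "((\<lambda>\<tau>. ?x + \<tau> *\<^sub>R v) has_vector_derivative v) (at 0)"
      by (auto intro!: derivative_eq_intros)
    then have "(?\<phi> \<circ> (\<lambda>\<tau>. ?x + \<tau> *\<^sub>R v) has_vector_derivative blinfun_apply (f' ?x) v) (at 0)"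
      using f'[OF x] by (intro vector_derivative_diff_chain_within) 
        (simp_all add: comp_def has_derivative_at_withinI)
    then have "((\<lambda>\<tau>. \<nu> \<bullet> (?\<phi> \<circ> (\<lambda>\<tau>. ?x + \<tau> *\<^sub>R v)) \<tau>) has_real_derivative \<nu> \<bullet> w) (at 0)"
      unfolding has_real_derivative_iff_has_vector_derivative w_eq
      by (rule bounded_linear.has_vector_derivative[OF bounded_linear_inner_right])
    then have "((\<lambda>\<tau>. (\<nu> \<bullet> ?\<phi> (?x + \<tau> *\<^sub>R v) - \<nu> \<bullet> ?\<phi> ?x) / \<tau>) \<longlongrightarrow> \<nu> \<bullet> w) (at 0)"
      by (simp add: DERIV_def)
    \<comment> \<open>\<open>bound\<close> controls positive \<tau> only, so the limit of the
      difference quotients is taken from the right.\<close>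
    then have "((\<lambda>\<tau>. (\<nu> \<bullet> ?\<phi> (?x + \<tau> *\<^sub>R v) - \<nu> \<bullet> ?\<phi> ?x) / \<tau>) \<longlongrightarrow> \<nu> \<bullet> w) (at_right 0)"
      by (rule tendsto_mono[OF at_le, rotated]) simp
    moreover have "\<forall>\<^sub>F \<tau> in at_right 0. (\<nu> \<bullet> ?\<phi> (?x + \<tau> *\<^sub>R v) - \<nu> \<bullet> ?\<phi> ?x) / \<tau> \<le> e * (norm w + \<eta>)"
      unfolding eventually_at_right_field
    proof (intro exI[of _ "r / (norm v + 1)"] conjI allI impI)
      \<comment> \<open>The added 1 covers v = 0.\<close>
      show "0 < r / (norm v + 1)"
        using r(1) by (simp add: add_nonneg_pos)
      fix \<tau> :: real assume \<tau>: "0 < \<tau>" "\<tau> < r / (norm v + 1)"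
      then have "\<tau> * (norm v + 1) < r"
        by (simp add: pos_less_divide_eq add_nonneg_pos)
      then have "\<tau> * norm v < r"
        using \<tau>(1) by (simp add: distrib_left)
      then show "(\<nu> \<bullet> ?\<phi> (?x + \<tau> *\<^sub>R v) - \<nu> \<bullet> ?\<phi> ?x) / \<tau> \<le> e * (norm w + \<eta>)"
        using bound[OF \<tau>(1)] \<tau>(1) by (simp add: pos_divide_le_eq inner_diff_right mult_ac)
    qed
    ultimately show ?thesis
      by (rule tendsto_upperbound) simp
  qed
  then have "\<nu> \<bullet> w \<le> e * norm w + \<epsilon>" if "\<epsilon> > 0" for \<epsilon>
  proof -
    \<comment> \<open>The value of \<eta> that makes the error at most \<epsilon>; e + 1 instead of
      e covers e = 0.\<close>
    have "e * (\<epsilon> / (e + 1)) \<le> \<epsilon>"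
      using that \<open>e \<ge> 0\<close> by (simp add: divide_simps)
    moreover have "\<epsilon> / (e + 1) > 0"
      using that \<open>e \<ge> 0\<close> by simp
    ultimately show ?thesis
      using \<open>\<And>\<eta>. \<eta> > 0 \<Longrightarrow> \<nu> \<bullet> w \<le> e * (norm w + \<eta>)\<close>[of "\<epsilon> / (e + 1)"] by (simp add: distrib_left)
  qed
  then show ?thesis
    by (rule field_le_epsilon)
qed

text \<open>Ekeland's principle produces a different point z for each \<nu>; the Gauss map
  transports normality from all of them back to the common q. Of the allowance \<eta>, a quarter is
  spent on the slope at z and a half on the oscillation of the Gauss map.\<close>

lemma close_normal_vectors:
  assumes complete: mcomplete
    and gauss: "uniformly_continuous_map (riemannian_metric X A g) (grassmannian_metric k) (gauss_map A h)"
    and unit: "\<And>\<nu>. \<nu> \<in> N \<Longrightarrow> norm \<nu> = 1"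
    and bound: "\<And>\<nu> q. \<nu> \<in> N \<Longrightarrow> q \<in> topspace X \<Longrightarrow> \<nu> \<bullet> h q \<le> b \<nu>"
    and approx: "\<And>\<epsilon>. \<epsilon> > 0 \<Longrightarrow> \<exists>q\<in>topspace X. \<forall>\<nu>\<in>N. \<nu> \<bullet> h q > b \<nu> - \<epsilon>"
    and "\<eta> > 0"
  obtains q where "q \<in> topspace X" "\<And>\<nu>. \<nu> \<in> N \<Longrightarrow> \<exists>y\<in>gauss_map A h q. dist \<nu> y < \<eta>"
proof -
  interpret G: Metric_space "grassmannian k" "grassmannian_dist k :: (real ^ 'n) set \<Rightarrow> _"
    by (rule Metric_space_grassmannian)
  have grass: "gauss_map A h q \<in> grassmannian k" if "q \<in> topspace X" for q
    using gauss that
    by (auto simp: uniformly_continuous_map_def grassmannian_metric_def mspace_riemannian_metric)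
  obtain \<delta> where \<delta>: "\<delta> > 0" "\<And>q z. q \<in> topspace X \<Longrightarrow> z \<in> topspace X \<Longrightarrow> rdist q z < \<delta> \<Longrightarrow>
      grassmannian_dist k (gauss_map A h q) (gauss_map A h z) < \<eta> / 2"
  proof -
    have "\<forall>\<epsilon>>0. \<exists>\<delta>>0. \<forall>z\<in>topspace X. \<forall>q\<in>topspace X. rdist q z < \<delta> \<longrightarrow>
        grassmannian_dist k (gauss_map A h q) (gauss_map A h z) < \<epsilon>"
      using gauss by (simp add: uniformly_continuous_map_def grassmannian_metric_def
          mspace_riemannian_metric mdist_riemannian_metric)
    then show thesis
      using that half_gt_zero[OF \<open>\<eta> > 0\<close>] by blast
  qed
  \<comment> \<open>With slope \<eta> / 4, a defect below \<open>\<eta> / 4 * \<delta>\<close> at q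
    leaves too little gain for z to be \<delta> or more away from q.\<close>
  obtain q where q: "q \<in> topspace X" "\<And>\<nu>. \<nu> \<in> N \<Longrightarrow> \<nu> \<bullet> h q > b \<nu> - \<eta> / 4 * \<delta>"
    using approx[of "\<eta> / 4 * \<delta>"] \<open>\<eta> > 0\<close> \<open>\<delta> > 0\<close> by auto
  show thesis
  proof (rule that[OF q(1)])
    fix \<nu> assume \<nu>: "\<nu> \<in> N"
    obtain z where z: "z \<in> topspace X" "\<eta> / 4 * rdist q z \<le> \<nu> \<bullet> h z - \<nu> \<bullet> h q"
      and crit: "\<And>y. y \<in> topspace X \<Longrightarrow> \<nu> \<bullet> h y \<le> \<nu> \<bullet> h z + \<eta> / 4 * rdist z y"
      by (rule ekeland[OF complete q(1) _ continuous_map_inner_immersion[of \<nu>] bound[OF \<nu>], of "\<eta> / 4"])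
        (use \<open>\<eta> > 0\<close> in auto)
    have "\<eta> / 4 * rdist q z < \<eta> / 4 * \<delta>"
      using z(2) q(2)[OF \<nu>] bound[OF \<nu> z(1)] by linarith
    then have "rdist q z < \<delta>"
      using \<open>\<eta> > 0\<close> by simp
    then have close: "grassmannian_dist k (gauss_map A h q) (gauss_map A h z) < \<eta> / 2"
      by (intro \<delta>(2) q z)
    let ?P = "\<lambda>q. closest_point (gauss_map A h q)"
    have sub: "subspace (gauss_map A h q)" "subspace (gauss_map A h z)"
      using grass q(1) z(1) by (auto simp: grassmannian_def)
    obtain c where "c \<in> A" "z \<in> fst c"
      using z(1) by (rule obtain_chart)
    then have cz: "c \<in> charts_at A z"
      by (simp add: charts_at_def)
    have "norm (\<nu> - ?P z \<nu>) \<le> \<eta> / 4"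
      unfolding gauss_map_def
    proof (rule norm_residual_le)
      show "subspace (pushforward A h z ` tangent_space A z)"
        unfolding pushforward_tangent_space[OF cz]
        using has_derivative_linear[OF coord_derivative_works[OF cz]]
        by (intro linear_subspace_image) auto
    qed (use inner_tangent_le[OF z(1) _ crit] \<open>\<eta> > 0\<close> in auto)
    \<comment> \<open>The Grassmannian distance is an operator norm, hence bounds how much the
      projection of the single vector \<nu> changes.\<close>
    moreover have "norm (?P q \<nu> - ?P z \<nu>) \<le> \<eta> / 2 * norm \<nu>"
    proof -
      have "bounded_linear (\<lambda>x. ?P q x - ?P z x)"
        by (intro bounded_linear_sub bounded_linear_closest_point sub)
      then have "norm (?P q \<nu> - ?P z \<nu>) \<le> grassmannian_dist k (gauss_map A h q) (gauss_map A h z) * norm \<nu>"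
        using onorm grass q(1) z(1) by (simp add: grassmannian_dist_def)
      then show ?thesis
        using close mult_right_mono[OF less_imp_le[OF close] norm_ge_zero] order_trans by blast
    qed
    ultimately have "dist \<nu> (?P q \<nu>) < \<eta>"
      using norm_triangle_ineq[of "\<nu> - ?P z \<nu>" "?P z \<nu> - ?P q \<nu>"] \<open>\<eta> > 0\<close> unit[OF \<nu>]
      by (simp add: dist_norm norm_minus_commute[of "?P q \<nu>"])
    then show "\<exists>y\<in>gauss_map A h q. dist \<nu> y < \<eta>"
      using closest_point_subspace(1)[OF sub(1)] by blast
  qed
qed

end

section \<open>Supporting hyperplanes\<close>

text \<open>A hyperplane determines its normal up to a factor: the part of a orthogonal to \<nu> is
  a direction of H, hence orthogonal to a as well and therefore 0. The sign of the factor stays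
  open, hence the disjunction.\<close>

lemma supporting_hyperplane_unit_normal:
  assumes "supporting_hyperplane C p H" "unit_normal H \<nu>"
  shows "(\<forall>x\<in>C. \<nu> \<bullet> x \<le> \<nu> \<bullet> p) \<or> (\<forall>x\<in>C. \<nu> \<bullet> x \<ge> \<nu> \<bullet> p)"
proof -
  obtain a b where a: "a \<noteq> 0" "H = {x. a \<bullet> x = b}" "p \<in> H"
    and C: "C \<subseteq> {x. a \<bullet> x \<le> b} \<or> C \<subseteq> {x. a \<bullet> x \<ge> b}"
    using assms(1) by (auto simp: supporting_hyperplane_def)
  obtain b' where \<nu>: "norm \<nu> = 1" "H = {x. \<nu> \<bullet> x = b'}"
    using assms(2) by (auto simp: unit_normal_def)
  have \<nu>\<nu>: "\<nu> \<bullet> \<nu> = 1"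
    using \<nu>(1) by (simp add: norm_eq_1)
  let ?w = "a - (a \<bullet> \<nu>) *\<^sub>R \<nu>"
  have "p + ?w \<in> H"
    using a(3) \<nu>\<nu> unfolding \<nu>(2) by (simp add: inner_add_right inner_diff_right inner_commute)
  then have "a \<bullet> ?w = 0"
    using a by (simp add: inner_add_right)
  moreover have "\<nu> \<bullet> ?w = 0"
    using \<nu>\<nu> by (simp add: inner_diff_right inner_commute)
  ultimately have "?w \<bullet> ?w = 0"
    by (simp only: inner_diff_left inner_scaleR_left)
  then have "a = (a \<bullet> \<nu>) *\<^sub>R \<nu>"
    by simp
  then obtain k where k: "a = k *\<^sub>R \<nu>"
    by blast
  have "k \<noteq> 0" "b = k * (\<nu> \<bullet> p)"
    using a unfolding k by auto
  then show ?thesis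
    using C unfolding k by (cases "k > 0") (auto simp: subset_iff mult_le_cancel_left)
qed

text \<open>If every point of S fell short by \<epsilon> for some \<nu>, the sum of all \<nu> would
  stay \<epsilon> below its value at p on S, hence on a closed half-space that contains the closed
  hull but not p.\<close>

lemma approx_all_supports:
  fixes p :: "'a::real_inner"
  assumes p: "p \<in> closure (convex hull S)" and "finite N"
    and le: "\<And>\<nu> x. \<nu> \<in> N \<Longrightarrow> x \<in> S \<Longrightarrow> \<nu> \<bullet> x \<le> \<nu> \<bullet> p" and "\<epsilon> > 0"
  shows "\<exists>x\<in>S. \<forall>\<nu>\<in>N. \<nu> \<bullet> x > \<nu> \<bullet> p - \<epsilon>"
proof (rule ccontr)
  assume contra: "\<not> ?thesis"
  have "S \<subseteq> {x. (\<Sum>\<nu>\<in>N. \<nu>) \<bullet> x \<le> (\<Sum>\<nu>\<in>N. \<nu>) \<bullet> p - \<epsilon>}"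
  proof
    fix x assume x: "x \<in> S"
    then obtain \<mu> where \<mu>: "\<mu> \<in> N" "\<mu> \<bullet> x \<le> \<mu> \<bullet> p - \<epsilon>"
      using contra by force
    have "(\<Sum>\<nu>\<in>N - {\<mu>}. \<nu> \<bullet> x) \<le> (\<Sum>\<nu>\<in>N - {\<mu>}. \<nu> \<bullet> p)"
      using le x by (intro sum_mono) auto
    then show "x \<in> {x. (\<Sum>\<nu>\<in>N. \<nu>) \<bullet> x \<le> (\<Sum>\<nu>\<in>N. \<nu>) \<bullet> p - \<epsilon>}"
      using \<mu> \<open>finite N\<close> by (simp add: inner_add_left inner_sum_left sum.remove)
  qed
  then have "closure (convex hull S) \<subseteq> {x. (\<Sum>\<nu>\<in>N. \<nu>) \<bullet> x \<le> (\<Sum>\<nu>\<in>N. \<nu>) \<bullet> p - \<epsilon>}"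
    by (intro closure_minimal hull_minimal convex_halfspace_le closed_halfspace_le)
  then show False
    using p \<open>\<epsilon> > 0\<close> by auto
qed

section \<open>Counting the supporting hyperplanes at a boundary point\<close>

theorem theorem1p4:
  fixes X :: "'a topology"
    and A :: "('a, 'm::finite) chart set"
    and g :: "'a \<Rightarrow> ('a, 'm) tangent \<Rightarrow> ('a, 'm) tangent \<Rightarrow> real"
    and h :: "'a \<Rightarrow> real ^ 'n::finite"
  assumes "riemannian_manifold X A g"
    and "mcomplete_of (riemannian_metric X A g)"
    and "CARD('n) > CARD('m)"
    and "C1_immersion X A h"
    and "isometric X A g h"
    and "substantial X h"
    and "uniformly_continuous_map (riemannian_metric X A g)
           (grassmannian_metric (CARD('n) - CARD('m))) (gauss_map A h)"
  shows "convex hull (h ` topspace X) = UNIV \<or>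
    (\<forall>p \<in> frontier (convex hull (h ` topspace X)).
       \<forall>s H. (\<forall>i\<in>{1..s}. supporting_hyperplane (convex hull (h ` topspace X)) p (H i)) \<and>
             general_position s H \<longrightarrow> s \<le> CARD('n) - CARD('m))"
proof (intro disjI2 ballI allI impI)
  interpret isometric_immersion X A g h
    using assms(1,4,5) by (intro isometric_immersion.intro isometric_immersion_axioms.intro)
  let ?C = "convex hull (h ` topspace X)"
  have complete: mcomplete
    using assms(2) by (simp add: riemannian_metric_def)
  \<comment> \<open>The second alternative is what is proved; if the hull is the whole space, its
    frontier is empty and the claim is vacuous.\<close>
  fix p s H
  assume "p \<in> frontier ?C"
    and H: "(\<forall>i\<in>{1..s}. supporting_hyperplane ?C p (H i)) \<and> general_position s H"
  then have p: "p \<in> closure ?C"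
    by (simp add: frontier_def)
  obtain \<nu> where \<nu>: "\<And>i. i \<in> {1..s} \<Longrightarrow> unit_normal (H i) (\<nu> i)"
    "inj_on \<nu> {1..s}" "independent (\<nu> ` {1..s})"
    using H unfolding general_position_def by blast
  define N where "N = \<nu> ` {1..s}"
  \<comment> \<open>Chosen before q, which is possible because \<eta> serves all subspaces at
    once.\<close>
  obtain \<eta> where \<eta>: "\<eta> > 0" "\<And>V. subspace V \<Longrightarrow>
      (\<And>\<nu>. \<nu> \<in> N \<Longrightarrow> \<exists>y\<in>V. dist \<nu> y < \<eta>) \<Longrightarrow> card N \<le> dim V"
    using independent_near_subspace[of N] \<nu>(3) by (auto simp: N_def)
  \<comment> \<open>Signs are adjusted so that each functional is maximal at p on the hull. They are
    undone at the end, as a subspace contains the negative of each of its vectors.\<close>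
  define outer where "outer \<mu> = (if \<forall>x\<in>?C. \<mu> \<bullet> x \<le> \<mu> \<bullet> p then \<mu> else - \<mu>)" for \<mu>
  have outer_le: "outer \<mu> \<bullet> x \<le> outer \<mu> \<bullet> p" if \<mu>: "\<mu> \<in> N" and x: "x \<in> ?C" for \<mu> x
  proof -
    obtain i where "i \<in> {1..s}" "\<mu> = \<nu> i"
      using \<mu> by (auto simp: N_def)
    then show ?thesis
      using supporting_hyperplane_unit_normal[of ?C p "H i" \<mu>] \<nu>(1)[of i] H x
      by (auto simp: outer_def)
  qed
  obtain q where q: "q \<in> topspace X"
    and near: "\<And>\<mu>. \<mu> \<in> outer ` N \<Longrightarrow> \<exists>y\<in>gauss_map A h q. dist \<mu> y < \<eta>"
  proof (rule close_normal_vectors[OF complete assms(7), of "outer ` N" "\<lambda>\<mu>. \<mu> \<bullet> p" \<eta>])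
    show "norm \<mu> = 1" if "\<mu> \<in> outer ` N" for \<mu>
      using that \<nu>(1) by (auto simp: N_def outer_def unit_normal_def split: if_splits)
    show le: "\<mu> \<bullet> h q \<le> \<mu> \<bullet> p" if "\<mu> \<in> outer ` N" "q \<in> topspace X" for \<mu> q
      using that outer_le hull_subset[of "h ` topspace X" convex] by blast
    have "finite (outer ` N)"
      by (simp add: N_def)
    then have "\<exists>x\<in>h ` topspace X. \<forall>\<mu>\<in>outer ` N. \<mu> \<bullet> x > \<mu> \<bullet> p - \<epsilon>" if "\<epsilon> > 0" for \<epsilon>
      by (rule approx_all_supports[OF p]) (use le that in auto)
    then show "\<exists>q\<in>topspace X. \<forall>\<mu>\<in>outer ` N. \<mu> \<bullet> p - \<epsilon> < \<mu> \<bullet> h q" if "\<epsilon> > 0" for \<epsilon>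
      using that by blast
  qed (use \<eta>(1) in auto)
  \<comment> \<open>\<open>uniformly_continuous_map\<close> includes that the values lie in the
    target space; this yields the dimension of the normal space.\<close>
  have "gauss_map A h q \<in> grassmannian (CARD('n) - CARD('m))"
    using assms(7) q Metric_space.mspace_metric[OF Metric_space_grassmannian]
    by (auto simp: uniformly_continuous_map_def grassmannian_metric_def mspace_riemannian_metric)
  then have V: "subspace (gauss_map A h q)" "dim (gauss_map A h q) = CARD('n) - CARD('m)"
    by (auto simp: grassmannian_def)
  have "\<exists>y\<in>gauss_map A h q. dist \<mu> y < \<eta>" if "\<mu> \<in> N" for \<mu>
  proof -
    obtain y where y: "y \<in> gauss_map A h q" "dist (outer \<mu>) y < \<eta>"
      using near \<open>\<mu> \<in> N\<close> by blast
    have "dist (- \<mu>) y = dist \<mu> (- y)"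
      using norm_minus_cancel[of "\<mu> + y"] by (simp add: dist_norm)
    then have "dist \<mu> y < \<eta> \<or> dist \<mu> (- y) < \<eta>"
      using y(2) by (auto simp: outer_def split: if_splits)
    then show ?thesis
      using y(1) subspace_neg[OF V(1) y(1)] by blast
  qed
  then have "card N \<le> dim (gauss_map A h q)"
    by (intro \<eta>(2) V)
  then show "s \<le> CARD('n) - CARD('m)"
    using V(2) card_image[OF \<nu>(2)] by (simp add: N_def)
qed

end
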